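(* As $d \to \infty$, $$K(d) \ge (1+o(1)) \sqrt{\frac{3\pi}{8}} \, \log\!\left( \frac{3}{2\sqrt{2}} \right) \cdot d^{3/2} \left( \frac{2}{\sqrt{3}} \right)^{d}.$$
   Context: $K(d)$ denotes the kissing number in dimension $d$: the maximum number of non-overlapping unit spheres in $\mathbb{R}^d$ that can touch a single unit sphere. Equivalently, $K(d)$ is the largest $k$ such that there exist unit vectors $x_1,\dots,x_k \in \mathbb{R}^d$ with $\langle x_i, x_j\rangle \le \cos(\pi/3) = 1/2$ for all $i \ne j$. Here $\log$ is the natural logarithm and $o(1)$ denotes a quantity tending to $0$ as $d\to\infty$. *)

theory Defs
  imports "HOL-Analysis.Analysis"
begin

text \<open>
  The dimension ranges over the natural numbers inside the statement, so a point of
  d-dimensional Euclidean space is an extensional function on the indices below d, and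
  distances are taken with \<^const>\<open>L2_set\<close>.
\<close>

definition euclid :: "nat \<Rightarrow> (nat \<Rightarrow> real) set" where
  "euclid d = {..<d} \<rightarrow>\<^sub>E UNIV"

definition euclid_dist :: "nat \<Rightarrow> (nat \<Rightarrow> real) \<Rightarrow> (nat \<Rightarrow> real) \<Rightarrow> real" where
  "euclid_dist d x y = L2_set (\<lambda>i. x i - y i) {..<d}"

definition euclid_inner :: "nat \<Rightarrow> (nat \<Rightarrow> real) \<Rightarrow> (nat \<Rightarrow> real) \<Rightarrow> real" where
  "euclid_inner d x y = (\<Sum>i<d. x i * y i)"

definition origin :: "nat \<Rightarrow> nat \<Rightarrow> real" where
  "origin d = (\<lambda>i\<in>{..<d}. 0)"

definition unit_ball :: "nat \<Rightarrow> (nat \<Rightarrow> real) \<Rightarrow> (nat \<Rightarrow> real) set" where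
  "unit_ball d c = {x \<in> euclid d. euclid_dist d c x < 1}"

definition unit_sphere :: "nat \<Rightarrow> (nat \<Rightarrow> real) \<Rightarrow> (nat \<Rightarrow> real) set" where
  "unit_sphere d c = {x \<in> euclid d. euclid_dist d c x = 1}"

text \<open>
  Unit spheres are given by their centres. They do not overlap if the open balls they bound
  are disjoint, and they touch if in addition the spheres themselves meet.
\<close>

definition non_overlapping :: "nat \<Rightarrow> (nat \<Rightarrow> real) \<Rightarrow> (nat \<Rightarrow> real) \<Rightarrow> bool" where
  "non_overlapping d a b \<longleftrightarrow> unit_ball d a \<inter> unit_ball d b = {}"

definition touching :: "nat \<Rightarrow> (nat \<Rightarrow> real) \<Rightarrow> (nat \<Rightarrow> real) \<Rightarrow> bool" where
  "touching d a b \<longleftrightarrow> non_overlapping d a b \<and> unit_sphere d a \<inter> unit_sphere d b \<noteq> {}"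

definition kissing_configuration :: "nat \<Rightarrow> (nat \<Rightarrow> real) set \<Rightarrow> bool" where
  "kissing_configuration d C \<longleftrightarrow>
     finite C \<and> C \<subseteq> euclid d \<and> (\<forall>c\<in>C. touching d (origin d) c) \<and>
     pairwise (non_overlapping d) C"

definition kissing_number :: "nat \<Rightarrow> nat" where
  "kissing_number d = Max {card C | C. kissing_configuration d C}"


lemma euclid_dist_commute: "euclid_dist d x y = euclid_dist d y x"
  by (simp add: euclid_dist_def L2_set_def power2_commute)

lemma euclid_dist_triangle: "euclid_dist d x z \<le> euclid_dist d x y + euclid_dist d y z"
  using L2_set_triangle_ineq[of "\<lambda>i. x i - y i" "\<lambda>i. y i - z i" "{..<d}"]
  by (simp add: euclid_dist_def)

lemma midpoint_euclid:
  obtains m where "m \<in> euclid d" "euclid_dist d a m = euclid_dist d a b / 2"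
    "euclid_dist d b m = euclid_dist d a b / 2"
proof
  let ?m = "\<lambda>i\<in>{..<d}. (a i + b i) / 2"
  show "?m \<in> euclid d"
    by (simp add: euclid_def)
  have "euclid_dist d a ?m = L2_set (\<lambda>i. (1/2) * (a i - b i)) {..<d}"
    unfolding euclid_dist_def by (rule L2_set_cong) (auto simp: field_simps)
  also have "\<dots> = (1/2) * euclid_dist d a b"
    unfolding euclid_dist_def by (subst L2_set_right_distrib[symmetric]) auto
  finally show "euclid_dist d a ?m = euclid_dist d a b / 2"
    by simp
  have "euclid_dist d b ?m = L2_set (\<lambda>i. (1/2) * (b i - a i)) {..<d}"
    unfolding euclid_dist_def by (rule L2_set_cong) (auto simp: field_simps)
  also have "\<dots> = (1/2) * euclid_dist d b a"
    unfolding euclid_dist_def by (subst L2_set_right_distrib[symmetric]) auto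
  finally show "euclid_dist d b ?m = euclid_dist d a b / 2"
    by (simp add: euclid_dist_commute)
qed

lemma non_overlapping_iff: "non_overlapping d a b \<longleftrightarrow> 2 \<le> euclid_dist d a b"
proof
  assume "non_overlapping d a b"
  moreover obtain m where "m \<in> euclid d" "euclid_dist d a m = euclid_dist d a b / 2"
    "euclid_dist d b m = euclid_dist d a b / 2"
    by (rule midpoint_euclid)
  ultimately show "2 \<le> euclid_dist d a b"
    by (force simp: non_overlapping_def unit_ball_def)
next
  assume 2: "2 \<le> euclid_dist d a b"
  have False if "euclid_dist d a x < 1" "euclid_dist d b x < 1" for x
    using that 2 euclid_dist_triangle[of d a b x] by (simp add: euclid_dist_commute[of d x b])
  then show "non_overlapping d a b"
    by (auto simp: non_overlapping_def unit_ball_def)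
qed

lemma touching_iff: "touching d a b \<longleftrightarrow> euclid_dist d a b = 2"
proof
  assume t: "touching d a b"
  then obtain x where "euclid_dist d a x = 1" "euclid_dist d b x = 1"
    by (auto simp: touching_def unit_sphere_def)
  then have "euclid_dist d a b \<le> 2"
    using euclid_dist_triangle[of d a b x] by (simp add: euclid_dist_commute[of d x b])
  then show "euclid_dist d a b = 2"
    using t by (simp add: touching_def non_overlapping_iff)
next
  assume 2: "euclid_dist d a b = 2"
  moreover obtain m where "m \<in> euclid d" "euclid_dist d a m = euclid_dist d a b / 2"
    "euclid_dist d b m = euclid_dist d a b / 2"
    by (rule midpoint_euclid)
  ultimately show "touching d a b"
    by (force simp: touching_def non_overlapping_iff unit_sphere_def)
qed

lemma euclid_dist_origin: "euclid_dist d (origin d) x = L2_set x {..<d}"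
  by (simp add: euclid_dist_def origin_def L2_set_def)

lemma kissing_configuration_iff:
  "kissing_configuration d C \<longleftrightarrow>
     finite C \<and> C \<subseteq> euclid d \<and> (\<forall>c\<in>C. L2_set c {..<d} = 2) \<and>
     pairwise (\<lambda>a b. 2 \<le> euclid_dist d a b) C"
  by (simp add: kissing_configuration_def touching_iff non_overlapping_iff[abs_def]
      euclid_dist_origin)

text \<open>The maximum in \<^const>\<open>kissing_number\<close> is taken over a finite nonempty set.\<close>

lemma finite_kissing_cards: "finite {card C | C. kissing_configuration d C}"
proof -
  define h where "h = 1 / (real d + 1)"
  define g where "g = (\<lambda>x::nat \<Rightarrow> real. \<lambda>i\<in>{..<d}. \<lfloor>x i / h\<rfloor>)"
  define G where "G = ({..<d} \<rightarrow>\<^sub>E {\<lfloor>- 2 / h\<rfloor>..\<lfloor>2 / h\<rfloor>})"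
  have h: "h > 0"
    by (simp add: h_def)
  have "finite G"
    unfolding G_def by (intro finite_PiE) auto
  have "card C \<le> card G" if C: "kissing_configuration d C" for C
  proof (rule card_inj_on_le[of g])
    show "g ` C \<subseteq> G"
    proof
      fix y assume "y \<in> g ` C"
      then obtain x where x: "x \<in> C" "y = g x"
        by auto
      have x2: "\<bar>x i\<bar> \<le> 2" if "i < d" for i
        using member_le_L2_set[of "{..<d}" i "\<lambda>i. \<bar>x i\<bar>"] x C that
        by (simp add: kissing_configuration_iff L2_set_def)
      have "\<lfloor>- 2 / h\<rfloor> \<le> \<lfloor>x i / h\<rfloor> \<and> \<lfloor>x i / h\<rfloor> \<le> \<lfloor>2 / h\<rfloor>" if "i < d" for i
        using h x2[OF that] by (intro conjI floor_mono divide_right_mono) linarith+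
      then show "y \<in> G"
        unfolding G_def by (auto simp: g_def x)
    qed
    show "inj_on g C"
    proof (rule inj_onI, rule ccontr)
      fix x y assume xy: "x \<in> C" "y \<in> C" "g x = g y" "x \<noteq> y"
      have "\<bar>x i - y i\<bar> \<le> h" if "i < d" for i
      proof -
        have "\<lfloor>x i / h\<rfloor> = \<lfloor>y i / h\<rfloor>"
          using fun_cong[OF xy(3), of i] that by (simp add: g_def)
        then have "\<bar>x i / h - y i / h\<bar> < 1"
          by linarith
        then show ?thesis
          using h by (simp add: diff_divide_distrib[symmetric])
      qed
      then have "(\<Sum>i<d. \<bar>x i - y i\<bar>) \<le> real d * h"
        using sum_bounded_above[of "{..<d}" "\<lambda>i. \<bar>x i - y i\<bar>" h] by simp
      moreover have "real d * h < 2"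
        by (simp add: h_def field_simps)
      moreover have "euclid_dist d x y \<le> (\<Sum>i<d. \<bar>x i - y i\<bar>)"
        unfolding euclid_dist_def by (rule L2_set_le_sum_abs)
      moreover have "2 \<le> euclid_dist d x y"
        using C xy by (auto simp: kissing_configuration_iff pairwise_def)
      ultimately show False
        by linarith
    qed
  qed fact
  then have "{card C | C. kissing_configuration d C} \<subseteq> {..card G}"
    by auto
  then show ?thesis
    by (rule finite_subset) simp
qed

lemma kissing_configuration_empty: "kissing_configuration d {}"
  by (simp add: kissing_configuration_def)

lemma kissing_number_ge: "kissing_configuration d C \<Longrightarrow> card C \<le> kissing_number d"
  unfolding kissing_number_def by (rule Max_ge[OF finite_kissing_cards]) blast

text \<open>The description by unit vectors at pairwise angles at least \<open>\<pi>/3\<close>.\<close>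

definition spherical_code :: "nat \<Rightarrow> (nat \<Rightarrow> real) set \<Rightarrow> bool" where
  "spherical_code d X \<longleftrightarrow>
     finite X \<and> X \<subseteq> euclid d \<and> (\<forall>x\<in>X. euclid_inner d x x = 1) \<and>
     pairwise (\<lambda>x y. euclid_inner d x y \<le> cos (pi / 3)) X"

lemma euclid_dist_power2:
  "(euclid_dist d x y)\<^sup>2 = euclid_inner d x x - 2 * euclid_inner d x y + euclid_inner d y y"
proof -
  have "(euclid_dist d x y)\<^sup>2 = (\<Sum>i<d. (x i - y i)\<^sup>2)"
    by (simp add: euclid_dist_def L2_set_def sum_nonneg)
  then show ?thesis
    by (simp add: euclid_inner_def power2_eq_square algebra_simps sum.distrib sum_subtractf
        sum_distrib_left)
qed

lemma kissing_number_spherical_code: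
  "kissing_number d = Max {card X | X. spherical_code d X}"
proof -
  define s where "s = (\<lambda>(t::real) (x::nat \<Rightarrow> real). \<lambda>i\<in>{..<d}. t * x i)"
  have inner_s: "euclid_inner d (s t x) (s t y) = t\<^sup>2 * euclid_inner d x y" for t x y
    by (simp add: euclid_inner_def s_def sum_distrib_left power2_eq_square algebra_simps)
  have s_euclid: "s t x \<in> euclid d" for t x
    by (simp add: s_def euclid_def)
  have s_inj: "inj_on (s t) A" if "t \<noteq> 0" "A \<subseteq> euclid d" for t A
  proof (rule inj_onI)
    fix x y assume xy: "x \<in> A" "y \<in> A" "s t x = s t y"
    show "x = y"
    proof (rule PiE_ext)
      show "x \<in> {..<d} \<rightarrow>\<^sub>E UNIV" "y \<in> {..<d} \<rightarrow>\<^sub>E UNIV"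
        using xy that by (auto simp: euclid_def)
      show "x i = y i" if "i \<in> {..<d}" for i
        using fun_cong[OF xy(3), of i] that \<open>t \<noteq> 0\<close> by (simp add: s_def)
    qed
  qed
  have norm_iff: "L2_set x {..<d} = 2 \<longleftrightarrow> euclid_inner d x x = 4" for x
  proof -
    have "L2_set x {..<d} = sqrt (euclid_inner d x x)"
      by (simp add: L2_set_def euclid_inner_def power2_eq_square)
    moreover have "sqrt r = 2 \<longleftrightarrow> r = 4" for r :: real
      using real_sqrt_eq_iff[of r 4] by simp
    ultimately show ?thesis
      by simp
  qed
  have dist_iff: "2 \<le> euclid_dist d x y \<longleftrightarrow> euclid_inner d x y \<le> 2"
    if "euclid_inner d x x = 4" "euclid_inner d y y = 4" for x y
  proof -
    have "2 \<le> euclid_dist d x y \<longleftrightarrow> 2\<^sup>2 \<le> (euclid_dist d x y)\<^sup>2"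
      by (rule power_mono_iff[symmetric]) (simp_all add: euclid_dist_def)
    then show ?thesis
      using that by (simp add: euclid_dist_power2)
  qed
  have kiss: "kissing_configuration d C \<longleftrightarrow>
     finite C \<and> C \<subseteq> euclid d \<and> (\<forall>c\<in>C. euclid_inner d c c = 4) \<and>
     pairwise (\<lambda>a b. euclid_inner d a b \<le> 2) C" for C
    unfolding kissing_configuration_iff norm_iff
    using dist_iff by (auto simp: pairwise_def)
  have "(\<exists>C. n = card C \<and> kissing_configuration d C) \<longleftrightarrow>
        (\<exists>X. n = card X \<and> spherical_code d X)" for n
  proof (intro iffI; elim exE conjE)
    fix C assume C: "n = card C" "kissing_configuration d C"
    have "spherical_code d (s (1/2) ` C)"
      using C(2) unfolding spherical_code_def kiss
      by (auto simp: pairwise_def inner_s s_euclid cos_60 power2_eq_square)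
    moreover have "card (s (1/2) ` C) = card C"
      using C(2) by (intro card_image s_inj) (auto simp: kiss)
    ultimately show "\<exists>X. n = card X \<and> spherical_code d X"
      using C(1) by metis
  next
    fix X assume X: "n = card X" "spherical_code d X"
    have "kissing_configuration d (s 2 ` X)"
      using X(2) unfolding spherical_code_def kiss
      by (auto simp: pairwise_def inner_s s_euclid cos_60 power2_eq_square mult.commute)
    moreover have "card (s 2 ` X) = card X"
      using X(2) by (intro card_image s_inj) (auto simp: spherical_code_def)
    ultimately show "\<exists>C. n = card C \<and> kissing_configuration d C"
      using X(1) by metis
  qed
  then show ?thesis
    unfolding kissing_number_def by simp
qed

end

theory Submission
  imports Defs "HOL-Real_Asymp.Real_Asymp"
begin

text \<open>
  Join two directions by an edge if the angle between them is less than \<open>\<pi>/3\<close>. Kissing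
  configurations are the independent sets of this graph, and the neighbourhood of a direction is
  a spherical cap of angular radius \<open>\<pi>/3\<close>. A greedy choice yields an independent set of relative
  size one over the measure of this cap. The additional factor of order \<open>d\<close> comes from
  sparsity inside the neighbourhoods: if \<open>x\<close> is a neighbour of \<open>v\<close>, then the common
  neighbours of \<open>x\<close> and \<open>v\<close> that are at least as close to \<open>v\<close> as \<open>x\<close> lie in a cap of
  angular radius \<open>arccos (1 / sqrt 3)\<close> only, whose measure is exponentially smaller.

  In a finite graph with degrees at most \<open>\<Delta>\<close> whose neighbourhoods induce subgraphs of average
  degree at most \<open>K\<close>, hereditarily, the hard-core model gives an independent set of size about
  \<open>(n / \<Delta>) ln (\<Delta> / K)\<close>. Choose an independent set \<open>I\<close> with probability proportional to
  \<open>\<phi> ^ card I\<close> and reveal it outside the neighbourhood of a vertex \<open>v\<close>. The part of the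
  neighbourhood that remains free carries a hard-core model of its own; let \<open>Z\<close> be its
  partition function. Then \<open>v\<close> is occupied with probability \<open>\<phi> / Z\<close>, while sparsity
  gives at least about \<open>ln Z\<close> occupied neighbours in expectation. A small \<open>Z\<close> makes the first
  quantity large and a large \<open>Z\<close> the second, and averaging over \<open>v\<close> turns both into
  lower bounds for the expected size of \<open>I\<close> (\<open>large_independent_set\<close>). With \<open>\<phi> = 1 / (K d)\<close>
  the correction factors tend to \<open>1\<close>, and \<open>ln (\<Delta> / K)\<close> is asymptotic to
  \<open>d ln (3 / (2 sqrt 2))\<close>, where \<open>3 / (2 sqrt 2)\<close> is the ratio of the sines of the two radii.

  The finite graph is formed by the integer points of a large ball with a small ball around the
  origin removed, joined according to the angle between them. Counting these points is comparing
  volumes of unit cubes with volumes of cones (\<open>card_lattice_shell_ge\<close>,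
  \<open>card_lattice_cone_le\<close>), and the comparison becomes exact in the limit. The volume of
  a cone with an arbitrary axis is reduced by plane rotations to that of a cone around a coordinate
  axis, which is integrated slice by slice (\<open>emeasure_cone_ball_le\<close>). What is left are the
  volumes of unit balls in consecutive dimensions, which the logarithmic convexity of the Gamma
  function compares (\<open>unit_ball_vol_ratio_le\<close>).
\<close>

section \<open>Independent sets in locally sparse graphs\<close>

text \<open>
  Adjacency is taken to be a reflexive relation, so that neighbourhoods are closed: they contain
  their centre, as caps do, and degrees count it.
\<close>

definition independent_sets :: "('a \<Rightarrow> 'a \<Rightarrow> bool) \<Rightarrow> 'a set \<Rightarrow> 'a set set" where
  "independent_sets E S = {I. I \<subseteq> S \<and> (\<forall>x\<in>I. \<forall>y\<in>I. E x y \<longrightarrow> x = y)}"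

definition partition_function :: "('a \<Rightarrow> 'a \<Rightarrow> bool) \<Rightarrow> real \<Rightarrow> 'a set \<Rightarrow> real" where
  "partition_function E \<phi> S = (\<Sum>I\<in>independent_sets E S. \<phi> ^ card I)"

lemma finite_independent_sets: "finite S \<Longrightarrow> finite (independent_sets E S)"
  by (rule finite_subset[of _ "Pow S"]) (auto simp: independent_sets_def)

lemma finite_independent_set: "finite S \<Longrightarrow> I \<in> independent_sets E S \<Longrightarrow> finite I"
  by (auto simp: independent_sets_def intro: finite_subset)

lemma partition_function_empty [simp]: "partition_function E \<phi> {} = 1"
proof -
  have "independent_sets E {} = {{}}"
    by (auto simp: independent_sets_def)
  then show ?thesis
    by (simp add: partition_function_def)
qed

lemma partition_function_ge_1:
  fixes S :: "'a set"
  assumes "finite S" "\<phi> > 0"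
  shows "partition_function E \<phi> S \<ge> 1"
proof -
  have "(\<Sum>I\<in>{{} :: 'a set}. \<phi> ^ card I) \<le> partition_function E \<phi> S"
    unfolding partition_function_def using assms
    by (intro sum_mono2 finite_independent_sets) (auto simp: independent_sets_def)
  then show ?thesis
    by simp
qed

text \<open>
  Removing \<open>x\<close> is a bijection from the independent sets that contain \<open>x\<close> to those that avoid
  its closed neighbourhood.
\<close>

lemma sum_independent_sets_containing:
  assumes "finite S" "x \<in> S" and E: "reflp E" "symp E"
  shows "(\<Sum>I\<in>{I \<in> independent_sets E S. x \<in> I}. \<phi> ^ card I)
    = \<phi> * partition_function E \<phi> (S - {y. E x y})"
  unfolding partition_function_def sum_distrib_left
proof (rule sum.reindex_bij_witness[of _ "insert x" "\<lambda>I. I - {x}"])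
  fix I assume I: "I \<in> independent_sets E (S - {y. E x y})"
  have "x \<notin> I"
    using I reflpD[OF E(1), of x] by (auto simp: independent_sets_def)
  then show "insert x I - {x} = I"
    by auto
  show "insert x I \<in> {I \<in> independent_sets E S. x \<in> I}"
    using I \<open>x \<in> S\<close> by (auto simp: independent_sets_def dest: sympD[OF E(2)])
next
  fix I assume I: "I \<in> {I \<in> independent_sets E S. x \<in> I}"
  then show "insert x (I - {x}) = I"
    by auto
  show "I - {x} \<in> independent_sets E (S - {y. E x y})"
    using I by (auto simp: independent_sets_def)
  have "finite I"
    using I assms(1) by (auto intro: finite_independent_set)
  then have "card I = Suc (card (I - {x}))"
    using I by (metis (no_types, lifting) mem_Collect_eq card_Suc_Diff1)
  then show "\<phi> * \<phi> ^ card (I - {x}) = \<phi> ^ card I"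
    by simp
qed

lemma sum_card_independent_sets:
  assumes "finite S" "T \<subseteq> S"
  shows "(\<Sum>I\<in>independent_sets E S. real (card (I \<inter> T)) * \<phi> ^ card I)
    = (\<Sum>x\<in>T. \<Sum>I\<in>{I \<in> independent_sets E S. x \<in> I}. \<phi> ^ card I)"
proof -
  have "finite T"
    using assms finite_subset by blast
  have "real (card (I \<inter> T)) * \<phi> ^ card I = (\<Sum>x\<in>T. if x \<in> I then \<phi> ^ card I else 0)"
    for I
    using \<open>finite T\<close> by (simp add: sum.If_cases Int_commute)
  then have "(\<Sum>I\<in>independent_sets E S. real (card (I \<inter> T)) * \<phi> ^ card I)
    = (\<Sum>I\<in>independent_sets E S. \<Sum>x\<in>T. if x \<in> I then \<phi> ^ card I else 0)"
    by simp
  also have "\<dots> = (\<Sum>x\<in>T. \<Sum>I\<in>independent_sets E S. if x \<in> I then \<phi> ^ card I else 0)"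
    by (rule sum.swap)
  also have "\<dots> = (\<Sum>x\<in>T. \<Sum>I\<in>{I \<in> independent_sets E S. x \<in> I}. \<phi> ^ card I)"
    using finite_independent_sets[OF assms(1)]
    by (intro sum.cong refl sum.inter_filter[symmetric])
  finally show ?thesis .
qed

lemma partition_function_insert_le:
  assumes "finite S" "\<phi> > 0"
  shows "partition_function E \<phi> (insert x S) \<le> (1 + \<phi>) * partition_function E \<phi> S"
proof (cases "x \<in> S")
  case True
  then show ?thesis
    using partition_function_ge_1[OF assms, of E] assms by (simp add: insert_absorb algebra_simps)
next
  case False
  have "independent_sets E (insert x S) \<subseteq> independent_sets E S \<union> insert x ` independent_sets E S"
  proof
    fix I assume I: "I \<in> independent_sets E (insert x S)"
    show "I \<in> independent_sets E S \<union> insert x ` independent_sets E S"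
    proof (cases "x \<in> I")
      case True
      then have "I = insert x (I - {x})" "I - {x} \<in> independent_sets E S"
        using I by (auto simp: independent_sets_def)
      then show ?thesis
        by blast
    qed (use I in \<open>auto simp: independent_sets_def\<close>)
  qed
  then have "partition_function E \<phi> (insert x S) \<le>
      (\<Sum>I\<in>independent_sets E S \<union> insert x ` independent_sets E S. \<phi> ^ card I)"
    unfolding partition_function_def using assms
    by (intro sum_mono2) (auto simp: finite_independent_sets)
  also have "\<dots> \<le> partition_function E \<phi> S + (\<Sum>I\<in>insert x ` independent_sets E S. \<phi> ^ card I)"
    unfolding partition_function_def using assms finite_independent_sets[OF assms(1), of E]
    by (subst sum_Un) (auto intro!: sum_nonneg)
  also have "(\<Sum>I\<in>insert x ` independent_sets E S. \<phi> ^ card I)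
      = (\<Sum>I\<in>independent_sets E S. \<phi> ^ card (insert x I))"
  proof (subst sum.reindex)
    have "x \<notin> I" if "I \<in> independent_sets E S" for I
      using that False by (auto simp: independent_sets_def)
    then show "inj_on (insert x) (independent_sets E S)"
      by (auto intro!: inj_onI dest: insert_ident)
  qed simp
  also have "\<dots> = \<phi> * partition_function E \<phi> S"
    unfolding partition_function_def sum_distrib_left
  proof (rule sum.cong[OF refl])
    fix I assume I: "I \<in> independent_sets E S"
    then have "finite I" "x \<notin> I"
      using False assms(1) by (auto simp: independent_sets_def finite_subset)
    then show "\<phi> ^ card (insert x I) = \<phi> * \<phi> ^ card I"
      by simp
  qed
  finally show ?thesis
    by (simp add: algebra_simps)
qed

text \<open>
  Each vertex multiplies the partition function by at most \<open>1 + \<phi> \<le> exp \<phi>\<close>. This bounds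
  both the cost of emptying a neighbourhood and, for \<open>B = S\<close>, the partition function itself.
\<close>

lemma partition_function_le_Diff:
  assumes "finite S" "\<phi> > 0" "B \<subseteq> S"
  shows "partition_function E \<phi> S \<le> exp (\<phi> * card B) * partition_function E \<phi> (S - B)"
proof -
  have "finite B"
    using assms finite_subset by blast
  then show ?thesis
    using assms(3)
  proof (induction B)
    case (insert x B)
    have eq: "S - B = insert x (S - insert x B)"
      using insert by auto
    have "partition_function E \<phi> (S - B) \<le> (1 + \<phi>) * partition_function E \<phi> (S - insert x B)"
      by (subst eq) (rule partition_function_insert_le, use assms in auto)
    also have "\<dots> \<le> exp \<phi> * partition_function E \<phi> (S - insert x B)"
      using partition_function_ge_1[of "S - insert x B" \<phi> E] assms
      by (intro mult_right_mono exp_ge_add_one_self) auto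
    finally have "exp (\<phi> * card B) * partition_function E \<phi> (S - B)
        \<le> exp (\<phi> * card B) * (exp \<phi> * partition_function E \<phi> (S - insert x B))"
      by (rule mult_left_mono) simp
    also have "\<dots> = exp (\<phi> * card (insert x B)) * partition_function E \<phi> (S - insert x B)"
      using insert by (simp add: exp_add algebra_simps)
    finally show ?case
      using insert by simp
  qed simp
qed

text \<open>
  The expected number of occupied vertices in a sparse graph. A vertex \<open>x\<close> of degree \<open>n\<close> is
  occupied with probability at least \<open>\<phi> exp (- \<phi> n)\<close>, because emptying its neighbourhood
  costs at most a factor \<open>exp (\<phi> n)\<close>. By convexity the degrees may be replaced by the
  bound \<open>K\<close> for their average, and \<open>\<phi> * card T\<close> is at least \<open>ln Z\<close>.
\<close>

lemma sum_card_ge_partition_ln: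
  assumes T: "finite T" and "\<phi> > 0" and E: "reflp E" "symp E"
    and sparse: "(\<Sum>x\<in>T. real (card {y \<in> T. E x y})) \<le> K * real (card T)"
  defines "Z \<equiv> partition_function E \<phi> T"
  shows "(\<Sum>I\<in>independent_sets E T. real (card I) * \<phi> ^ card I) \<ge> exp (- \<phi> * K) * (Z * ln Z)"
proof -
  have Z1: "Z \<ge> 1"
    unfolding Z_def using assms by (intro partition_function_ge_1)
  have "Z \<le> exp (\<phi> * card T)"
    using partition_function_le_Diff[OF T \<open>\<phi> > 0\<close> order.refl, of E] by (simp add: Z_def)
  then have lnZ: "ln Z \<le> \<phi> * card T"
    using Z1 by (metis ln_exp exp_gt_zero ln_le_cancel_iff less_le_trans zero_less_one)
  have "exp (- \<phi> * K) * (Z * ln Z) \<le> exp (- \<phi> * K) * (Z * (\<phi> * card T))"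
    using lnZ Z1 by (intro mult_left_mono) auto
  also have "\<dots> \<le> \<phi> * Z * (exp (- \<phi> * K) * (card T + \<phi> * (K * card T - (\<Sum>x\<in>T. real (card {y \<in> T. E x y})))))"
  proof -
    have "exp (- \<phi> * K) * card T \<le> exp (- \<phi> * K) * (card T + \<phi> * (K * card T - (\<Sum>x\<in>T. real (card {y \<in> T. E x y}))))"
      using sparse \<open>\<phi> > 0\<close> by simp
    from mult_left_mono[OF this, of "\<phi> * Z"] show ?thesis
      using Z1 \<open>\<phi> > 0\<close> by (simp add: algebra_simps)
  qed
  also have "\<dots> = (\<Sum>x\<in>T. \<phi> * Z * (exp (- \<phi> * K) * (1 + (\<phi> * K - \<phi> * card {y \<in> T. E x y}))))"
    by (simp add: sum_distrib_left[symmetric] sum.distrib sum_subtractf algebra_simps)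
  also have "\<dots> \<le> (\<Sum>x\<in>T. \<phi> * partition_function E \<phi> (T - {y. E x y}))"
  proof (rule sum_mono)
    fix x assume "x \<in> T"
    let ?n = "real (card {y \<in> T. E x y})"
    \<comment> \<open>the tangent of \<open>exp\<close> at the average degree replaces Jensen\<open>\<close>s inequality\<close>
    have "exp (- \<phi> * K) * (1 + (\<phi> * K - \<phi> * ?n)) \<le> exp (- \<phi> * K) * exp (\<phi> * K - \<phi> * ?n)"
      by (intro mult_left_mono exp_ge_add_one_self) auto
    also have "\<dots> = exp (- (\<phi> * ?n))"
      by (simp add: exp_add[symmetric])
    finally have "Z * (exp (- \<phi> * K) * (1 + (\<phi> * K - \<phi> * ?n))) \<le> Z * exp (- (\<phi> * ?n))"
      using Z1 by (intro mult_left_mono) auto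
    also have "\<dots> \<le> partition_function E \<phi> (T - {y \<in> T. E x y})"
      using partition_function_le_Diff[OF T \<open>\<phi> > 0\<close>, of "{y \<in> T. E x y}" E]
      by (simp add: Z_def exp_minus field_simps)
    also have "T - {y \<in> T. E x y} = T - {y. E x y}"
      by auto
    finally show "\<phi> * Z * (exp (- \<phi> * K) * (1 + (\<phi> * K - \<phi> * ?n)))
      \<le> \<phi> * partition_function E \<phi> (T - {y. E x y})"
      using \<open>\<phi> > 0\<close> by simp
  qed
  also have "\<dots> = (\<Sum>x\<in>T. \<Sum>I\<in>{I \<in> independent_sets E T. x \<in> I}. \<phi> ^ card I)"
    using sum_independent_sets_containing[OF T _ E] by simp
  also have "\<dots> = (\<Sum>I\<in>independent_sets E T. real (card (I \<inter> T)) * \<phi> ^ card I)"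
    by (rule sum_card_independent_sets[OF T order.refl, symmetric])
  also have "\<dots> = (\<Sum>I\<in>independent_sets E T. real (card I) * \<phi> ^ card I)"
    by (intro sum.cong refl) (auto simp: independent_sets_def Int_absorb2)
  finally show ?thesis .
qed

text \<open>
  The spatial Markov property of the hard-core model: given the part \<open>J\<close> of an independent set
  outside \<open>A\<close>, the part inside \<open>A\<close> is an arbitrary independent set of the vertices of \<open>A\<close> that
  \<open>J\<close> does not block.
\<close>

lemma sum_independent_sets_decompose:
  assumes "finite S" and E: "symp E" and "A \<subseteq> S"
  defines "free \<equiv> \<lambda>J. {w \<in> A. \<forall>j\<in>J. \<not> E j w}"
  shows "(\<Sum>I\<in>independent_sets E S. f I) =
    (\<Sum>J\<in>independent_sets E (S - A). \<Sum>L\<in>independent_sets E (free J). f (J \<union> L))"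
proof -
  have fin: "finite (free J)" for J
    using finite_subset[OF \<open>A \<subseteq> S\<close> \<open>finite S\<close>] by (simp add: free_def)
  have "(\<Sum>J\<in>independent_sets E (S - A). \<Sum>L\<in>independent_sets E (free J). f (J \<union> L)) =
    (\<Sum>(J, L)\<in>Sigma (independent_sets E (S - A)) (\<lambda>J. independent_sets E (free J)). f (J \<union> L))"
    using \<open>finite S\<close> fin by (intro sum.Sigma) (auto intro!: finite_independent_sets)
  also have "\<dots> = (\<Sum>I\<in>independent_sets E S. f I)"
  proof (rule sum.reindex_bij_witness[of _ "\<lambda>I. (I - A, I \<inter> A)" "\<lambda>(J, L). J \<union> L"])
    fix P assume P: "P \<in> Sigma (independent_sets E (S - A)) (\<lambda>J. independent_sets E (free J))"
    obtain J L where JL: "P = (J, L)"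
      by (cases P)
    have J: "J \<subseteq> S - A" "\<And>x y. x \<in> J \<Longrightarrow> y \<in> J \<Longrightarrow> E x y \<Longrightarrow> x = y"
      and L: "L \<subseteq> A" "\<And>x y. x \<in> L \<Longrightarrow> y \<in> L \<Longrightarrow> E x y \<Longrightarrow> x = y"
        "\<And>x y. x \<in> J \<Longrightarrow> y \<in> L \<Longrightarrow> \<not> E x y"
      using P by (auto simp: JL independent_sets_def free_def)
    show "((case P of (J, L) \<Rightarrow> J \<union> L) - A, (case P of (J, L) \<Rightarrow> J \<union> L) \<inter> A) = P"
      using J(1) L(1) by (auto simp: JL)
    have "x = y" if "x \<in> J \<union> L" "y \<in> J \<union> L" "E x y" for x y
      using that J(2) L(2,3) sympD[OF E \<open>E x y\<close>] by (elim UnE) blast+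
    then have "J \<union> L \<in> independent_sets E S"
      unfolding independent_sets_def using J(1) L(1) \<open>A \<subseteq> S\<close> by blast
    then show "(case P of (J, L) \<Rightarrow> J \<union> L) \<in> independent_sets E S"
      by (simp add: JL)
    show "f (case P of (J, L) \<Rightarrow> J \<union> L) = (case P of (J, L) \<Rightarrow> f (J \<union> L))"
      by (simp add: JL)
  next
    fix I assume "I \<in> independent_sets E S"
    then show "(I - A, I \<inter> A) \<in> Sigma (independent_sets E (S - A)) (\<lambda>J. independent_sets E (free J))"
      by (auto simp: independent_sets_def free_def)
  qed auto
  finally show ?thesis ..
qed

text \<open>
  The trade-off at one vertex. Conditioned on the configuration outside the neighbourhood of
  \<open>v\<close>, with \<open>Z\<close> the partition function of the unblocked neighbours, the two terms contribute
  \<open>exp z / Z\<close> and at least \<open>ln Z\<close>. The weights are chosen such that their sum, as a function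
  of \<open>ln Z\<close>, has its minimum \<open>1 + z\<close> at \<open>ln Z = z\<close>.
\<close>

lemma local_occupancy:
  assumes S: "finite S" and "v \<in> S" and "\<phi> > 0" and E: "reflp E" "symp E"
    and sparse: "\<And>T. T \<subseteq> {w \<in> S. E v w} \<Longrightarrow>
      (\<Sum>x\<in>T. real (card {y \<in> T. E x y})) \<le> K * real (card T)"
  shows "(\<Sum>I\<in>independent_sets E S. \<phi> ^ card I *
      (exp z / \<phi> * of_bool (v \<in> I) + exp (\<phi> * K) * card (I \<inter> {w \<in> S. E v w})))
    \<ge> (1 + z) * partition_function E \<phi> S"
proof -
  define A where "A = {w \<in> S. E v w}"
  define free where "free = (\<lambda>J. {w \<in> A. \<forall>j\<in>J. \<not> E j w})"
  define g where "g = (\<lambda>I. exp z / \<phi> * of_bool (v \<in> I) + exp (\<phi> * K) * real (card (I \<inter> A)))"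
  have A: "A \<subseteq> S" "finite A" "v \<in> A"
    using S \<open>v \<in> S\<close> reflpD[OF E(1)] by (auto simp: A_def)
  have main: "(1 + z) * (\<Sum>L\<in>independent_sets E (free J). \<phi> ^ card (J \<union> L))
      \<le> (\<Sum>L\<in>independent_sets E (free J). \<phi> ^ card (J \<union> L) * g (J \<union> L))"
    if J: "J \<in> independent_sets E (S - A)" for J
  proof -
    define T where "T = free J"
    have T: "T \<subseteq> A" "finite T"
      using A(2) by (auto simp: T_def free_def)
    have JA: "J \<inter> A = {}" "finite J"
      using J S by (auto simp: independent_sets_def finite_subset)
    \<comment> \<open>nothing outside the neighbourhood of \<open>v\<close> blocks \<open>v\<close> itself\<close>
    have vT: "v \<in> T"
      using A(3) J sympD[OF E(2)] by (auto simp: T_def free_def A_def independent_sets_def)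
    define Z where "Z = partition_function E \<phi> T"
    have Z1: "Z \<ge> 1"
      unfolding Z_def using T \<open>\<phi> > 0\<close> by (intro partition_function_ge_1)
    have L: "\<phi> ^ card (J \<union> L) = \<phi> ^ card J * \<phi> ^ card L"
      "g (J \<union> L) = exp z / \<phi> * of_bool (v \<in> L) + exp (\<phi> * K) * real (card L)"
      if "L \<in> independent_sets E T" for L
    proof -
      have "L \<subseteq> A" "finite L"
        using that T finite_independent_set[OF T(2) that] by (auto simp: independent_sets_def)
      moreover have "(J \<union> L) \<inter> A = L" "v \<notin> J" "J \<inter> L = {}"
        using JA \<open>L \<subseteq> A\<close> A(3) by auto
      ultimately show "\<phi> ^ card (J \<union> L) = \<phi> ^ card J * \<phi> ^ card L"
         "g (J \<union> L) = exp z / \<phi> * of_bool (v \<in> L) + exp (\<phi> * K) * real (card L)"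
        using JA by (simp_all add: card_Un_disjoint power_add g_def)
    qed
    have "T - {y. E v y} = {}"
      using T(1) by (auto simp: A_def)
    have v_term: "(\<Sum>L\<in>independent_sets E T. of_bool (v \<in> L) * \<phi> ^ card L) = \<phi>"
    proof -
      have "(\<Sum>L\<in>independent_sets E T. of_bool (v \<in> L) * \<phi> ^ card L)
          = (\<Sum>L\<in>{L \<in> independent_sets E T. v \<in> L}. \<phi> ^ card L)"
        by (subst sum.inter_filter[OF finite_independent_sets[OF T(2)]]) (auto intro!: sum.cong)
      then show ?thesis
        using sum_independent_sets_containing[OF T(2) vT E, of \<phi>] \<open>T - {y. E v y} = {}\<close> by simp
    qed
    \<comment> \<open>the convex function \<open>exp (z - x) + x\<close> lies above its minimum at \<open>x = z\<close>\<close>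
    have "(1 + z) * Z \<le> exp z + Z * ln Z"
    proof -
      have "(1 + (z - ln Z)) * Z \<le> exp (z - ln Z) * Z"
        using Z1 by (intro mult_right_mono exp_ge_add_one_self) auto
      also have "\<dots> = exp z"
        using Z1 by (simp add: exp_diff)
      finally show ?thesis
        by (simp add: algebra_simps)
    qed
    also have "Z * ln Z \<le> exp (\<phi> * K) * (\<Sum>L\<in>independent_sets E T. real (card L) * \<phi> ^ card L)"
    proof -
      have "exp (- \<phi> * K) * (Z * ln Z) \<le> (\<Sum>L\<in>independent_sets E T. real (card L) * \<phi> ^ card L)"
        unfolding Z_def using sparse[of T] T
        by (intro sum_card_ge_partition_ln \<open>\<phi> > 0\<close> E) (auto simp: A_def)
      then show ?thesis
        by (simp add: exp_minus field_simps)
    qed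
    also have "exp z + exp (\<phi> * K) * (\<Sum>L\<in>independent_sets E T. real (card L) * \<phi> ^ card L)
      = exp z / \<phi> * (\<Sum>L\<in>independent_sets E T. of_bool (v \<in> L) * \<phi> ^ card L)
        + exp (\<phi> * K) * (\<Sum>L\<in>independent_sets E T. real (card L) * \<phi> ^ card L)"
      using \<open>\<phi> > 0\<close> by (simp add: v_term)
    also have "\<dots> = (\<Sum>L\<in>independent_sets E T. \<phi> ^ card L *
        (exp z / \<phi> * of_bool (v \<in> L) + exp (\<phi> * K) * real (card L)))"
      by (simp add: sum_distrib_left sum.distrib[symmetric] algebra_simps)
    finally have "\<phi> ^ card J * ((1 + z) * Z) \<le> \<phi> ^ card J * (\<Sum>L\<in>independent_sets E T. \<phi> ^ card L *
        (exp z / \<phi> * of_bool (v \<in> L) + exp (\<phi> * K) * real (card L)))"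
      using \<open>\<phi> > 0\<close> by (intro mult_left_mono) auto
    moreover have "(1 + z) * (\<Sum>L\<in>independent_sets E T. \<phi> ^ card (J \<union> L)) = \<phi> ^ card J * ((1 + z) * Z)"
      by (simp add: L Z_def partition_function_def sum_distrib_left algebra_simps)
    moreover have "(\<Sum>L\<in>independent_sets E T. \<phi> ^ card (J \<union> L) * g (J \<union> L)) =
      \<phi> ^ card J * (\<Sum>L\<in>independent_sets E T. \<phi> ^ card L *
        (exp z / \<phi> * of_bool (v \<in> L) + exp (\<phi> * K) * real (card L)))"
      unfolding sum_distrib_left by (intro sum.cong refl) (simp only: L mult.assoc)
    ultimately show ?thesis
      unfolding T_def by (simp only:)
  qed
  have "(1 + z) * partition_function E \<phi> S = (\<Sum>J\<in>independent_sets E (S - A).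
      (1 + z) * (\<Sum>L\<in>independent_sets E (free J). \<phi> ^ card (J \<union> L)))"
    unfolding partition_function_def free_def
    by (subst sum_independent_sets_decompose[OF S E(2) A(1)]) (simp add: sum_distrib_left)
  also have "\<dots> \<le> (\<Sum>J\<in>independent_sets E (S - A).
      \<Sum>L\<in>independent_sets E (free J). \<phi> ^ card (J \<union> L) * g (J \<union> L))"
    by (intro sum_mono main)
  also have "\<dots> = (\<Sum>I\<in>independent_sets E S. \<phi> ^ card I * g I)"
    unfolding free_def by (rule sum_independent_sets_decompose[OF S E(2) A(1), symmetric])
  finally show ?thesis
    by (simp add: g_def A_def)
qed

text \<open>
  Summing the local trade-off over all vertices counts every occupied vertex once in the first
  term and at most \<open>\<Delta>\<close> times in the second. Some independent set is at least as large as the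
  resulting bound for the mean. The parameters \<open>\<phi>\<close> and \<open>z\<close> are free; the
  best \<open>z\<close> is slightly less than \<open>ln (\<phi> * \<Delta>)\<close> if \<open>\<phi> * \<Delta>\<close> is large.
\<close>

theorem large_independent_set:
  assumes S: "finite S" and "\<phi> > 0" and E: "reflp E" "symp E"
    and deg: "\<And>v. v \<in> S \<Longrightarrow> real (card {w \<in> S. E v w}) \<le> \<Delta>"
    and sparse: "\<And>v T. v \<in> S \<Longrightarrow> T \<subseteq> {w \<in> S. E v w} \<Longrightarrow>
      (\<Sum>x\<in>T. real (card {y \<in> T. E x y})) \<le> K * real (card T)"
  obtains I where "I \<in> independent_sets E S"
    "(1 + z) * real (card S) \<le> (exp z / \<phi> + exp (\<phi> * K) * \<Delta>) * real (card I)"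
proof -
  define N where "N = (\<lambda>v. {w \<in> S. E v w})"
  define c where "c = exp z / \<phi> + exp (\<phi> * K) * \<Delta>"
  have "(\<Sum>I\<in>independent_sets E S. \<phi> ^ card I * ((1 + z) * real (card S)))
      = (\<Sum>v\<in>S. (1 + z) * partition_function E \<phi> S)"
    by (simp add: partition_function_def sum_distrib_left sum_distrib_right algebra_simps)
  also have "\<dots> \<le> (\<Sum>v\<in>S. \<Sum>I\<in>independent_sets E S. \<phi> ^ card I *
      (exp z / \<phi> * of_bool (v \<in> I) + exp (\<phi> * K) * card (I \<inter> N v)))"
    unfolding N_def using sparse by (intro sum_mono local_occupancy S \<open>\<phi> > 0\<close> E) auto
  also have "\<dots> = (\<Sum>I\<in>independent_sets E S. \<phi> ^ card I *
      (exp z / \<phi> * (\<Sum>v\<in>S. of_bool (v \<in> I)) + exp (\<phi> * K) * (\<Sum>v\<in>S. real (card (I \<inter> N v)))))"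
    by (subst sum.swap) (simp add: sum_distrib_left sum.distrib algebra_simps)
  also have "\<dots> \<le> (\<Sum>I\<in>independent_sets E S. \<phi> ^ card I * (c * real (card I)))"
  proof (intro sum_mono mult_left_mono)
    fix I assume I: "I \<in> independent_sets E S"
    then have IS: "I \<subseteq> S" "finite I"
      using S by (auto simp: independent_sets_def finite_subset)
    have "(\<Sum>v\<in>S. of_bool (v \<in> I)) = real (card I)"
      using S IS by (simp add: of_bool_def sum.If_cases Int_absorb1)
    moreover have "(\<Sum>v\<in>S. real (card (I \<inter> N v))) \<le> \<Delta> * real (card I)"
    proof -
      have "card (I \<inter> N v) = (\<Sum>w\<in>I. of_bool (E v w))" for v
      proof -
        have "I \<inter> N v = I \<inter> {w. E v w}"
          using IS by (auto simp: N_def)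
        then show ?thesis
          using IS by (simp add: of_bool_def sum.If_cases)
      qed
      then have "(\<Sum>v\<in>S. real (card (I \<inter> N v))) = (\<Sum>v\<in>S. \<Sum>w\<in>I. of_bool (E v w))"
        by simp
      also have "\<dots> = (\<Sum>w\<in>I. \<Sum>v\<in>S. of_bool (E v w))"
        by (rule sum.swap)
      also have "\<dots> = (\<Sum>w\<in>I. real (card (N w)))"
      proof (intro sum.cong refl)
        fix w
        have "N w = S \<inter> {v. E v w}"
          using sympD[OF E(2)] by (auto simp: N_def)
        then show "(\<Sum>v\<in>S. of_bool (E v w)) = real (card (N w))"
          using S by (simp add: of_bool_def sum.If_cases)
      qed
      also have "\<dots> \<le> (\<Sum>w\<in>I. \<Delta>)"
        using IS deg by (intro sum_mono) (auto simp: N_def)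
      finally show ?thesis
        by (simp add: mult.commute)
    qed
    ultimately show "exp z / \<phi> * (\<Sum>v\<in>S. of_bool (v \<in> I)) + exp (\<phi> * K) * (\<Sum>v\<in>S. real (card (I \<inter> N v)))
        \<le> c * real (card I)"
      by (simp add: c_def algebra_simps)
  qed (use \<open>\<phi> > 0\<close> in auto)
  finally have le: "(\<Sum>I\<in>independent_sets E S. \<phi> ^ card I * ((1 + z) * real (card S)))
      \<le> (\<Sum>I\<in>independent_sets E S. \<phi> ^ card I * (c * real (card I)))" .
  have "\<exists>I\<in>independent_sets E S. (1 + z) * real (card S) \<le> c * real (card I)"
  proof (rule ccontr)
    assume "\<not> ?thesis"
    then have less: "c * real (card I) < (1 + z) * real (card S)" if "I \<in> independent_sets E S" for I
      using that not_le by blast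
    have "{} \<in> independent_sets E S"
      by (simp add: independent_sets_def)
    then have "independent_sets E S \<noteq> {}"
      by blast
    then have "(\<Sum>I\<in>independent_sets E S. \<phi> ^ card I * (c * real (card I)))
      < (\<Sum>I\<in>independent_sets E S. \<phi> ^ card I * ((1 + z) * real (card S)))"
      by (intro sum_strict_mono finite_independent_sets[OF S] mult_strict_left_mono less zero_less_power \<open>\<phi> > 0\<close>)
    with le show False
      by simp
  qed
  then show ?thesis
    using that by (auto simp: c_def)
qed

section \<open>The volume of a cone in a ball\<close>

abbreviation coord_lborel :: "'i set \<Rightarrow> ('i \<Rightarrow> real) measure" where
  "coord_lborel I \<equiv> Pi\<^sub>M I (\<lambda>_. lborel)"

interpretation coord: product_sigma_finite "\<lambda>_::'i. lborel :: real measure"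
  by standard

text \<open>
  The dimension is a variable, so Lebesgue measure is a product of copies of \<^const>\<open>lborel\<close>
  rather than the measure of a Euclidean space type. In one coordinate, the map below is a
  translation, possibly composed with a reflection, whose offset depends on the other coordinates;
  by Fubini it preserves the measure.
\<close>

lemma coord_lborel_shear:
  fixes h :: "('i \<Rightarrow> real) \<Rightarrow> real"
  assumes I: "finite I" "i \<in> I" and s: "\<bar>s\<bar> = 1"
    and h: "h \<in> borel_measurable (coord_lborel I)" "\<And>z y. h (z(i := y)) = h z"
    and f[measurable]: "f \<in> borel_measurable (coord_lborel I)"
  shows "(\<integral>\<^sup>+z. f (z(i := h z + s * z i)) \<partial>coord_lborel I) = (\<integral>\<^sup>+z. f z \<partial>coord_lborel I)"
proof -
  define A where "A = I - {i}"
  have A: "finite A" "i \<notin> A" "I = insert i A"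
    using I by (auto simp: A_def)
  have upd[measurable]: "(\<lambda>z. z(i := h z + s * z i)) \<in> measurable (coord_lborel I) (coord_lborel I)"
    using I h(1) by (intro measurable_fun_upd[where J = I]) (auto intro!: borel_measurable_add borel_measurable_times)
  have "(\<integral>\<^sup>+z. f (z(i := h z + s * z i)) \<partial>coord_lborel I)
      = (\<integral>\<^sup>+x. (\<integral>\<^sup>+y. f (x(i := h x + s * y)) \<partial>lborel) \<partial>coord_lborel A)"
    using coord.product_nn_integral_insert[OF A(1,2), of "\<lambda>z. f (z(i := h z + s * z i))"]
    by (simp add: A(3)[symmetric] h(2))
  also have "\<dots> = (\<integral>\<^sup>+x. (\<integral>\<^sup>+y. f (x(i := y)) \<partial>lborel) \<partial>coord_lborel A)"
  proof (rule nn_integral_cong)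
    fix x assume x: "x \<in> space (coord_lborel A)"
    have "(\<lambda>y. f (x(i := y))) \<in> borel_measurable borel"
      using measurable_comp[OF measurable_component_update[OF x A(2)] f[unfolded A(3)]]
      by (simp add: comp_def)
    from nn_integral_real_affine[OF this, of s "h x"] s
    show "(\<integral>\<^sup>+y. f (x(i := h x + s * y)) \<partial>lborel) = (\<integral>\<^sup>+y. f (x(i := y)) \<partial>lborel)"
      by auto
  qed
  also have "\<dots> = (\<integral>\<^sup>+z. f z \<partial>coord_lborel I)"
    using coord.product_nn_integral_insert[OF A(1,2), of f] f by (simp add: A(3)[symmetric])
  finally show ?thesis .
qed

text \<open>
  A plane rotation is a product of three shears:
  \<open>(1 p; 0 1) (1 0; - b 1) (1 p; 0 1) = (a b; - b a)\<close> for \<open>p = (1 - a) / b\<close>.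
\<close>

lemma coord_lborel_rotation:
  assumes I: "finite I" "i \<in> I" "j \<in> I" "i \<noteq> j" and ab: "a\<^sup>2 + b\<^sup>2 = 1" "b \<noteq> 0"
    and f[measurable]: "f \<in> borel_measurable (coord_lborel I)"
  shows "(\<integral>\<^sup>+z. f (z(i := a * z i + b * z j, j := a * z j - b * z i)) \<partial>coord_lborel I)
    = (\<integral>\<^sup>+z. f z \<partial>coord_lborel I)"
proof -
  define p where "p = (1 - a) / b"
  define S where "S = (\<lambda>k l t (z :: 'a \<Rightarrow> real). z(k := t * z l + 1 * z k))"
  have S_meas[measurable]: "S k l t \<in> measurable (coord_lborel I) (coord_lborel I)"
    if "k \<in> I" "l \<in> I" for k l t
    unfolding S_def using that
    by (intro measurable_fun_upd[where J = I]) (auto intro!: borel_measurable_add borel_measurable_times)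
  have S: "(\<integral>\<^sup>+z. g (S k l t z) \<partial>coord_lborel I) = (\<integral>\<^sup>+z. g z \<partial>coord_lborel I)"
    if "k \<in> I" "l \<in> I" "k \<noteq> l" "g \<in> borel_measurable (coord_lborel I)" for k l t g
    unfolding S_def using that I(1) by (intro coord_lborel_shear) auto
  have a: "a = 1 - p * b"
    using ab(2) by (simp add: p_def)
  have b: "b = p * (1 + a)"
    using ab by (simp add: p_def field_simps power2_eq_square)
  have S2: "a * v - b * u = v - b * (p * v + u)" for u v
    by (subst a) (simp add: algebra_simps)
  have S3: "a * u + b * v = p * (a * v - b * u) + (p * v + u)" for u v
    by (subst b, subst a) (simp add: algebra_simps)
  have "z(i := a * z i + b * z j, j := a * z j - b * z i) = S i j p (S j i (-b) (S i j p z))" for z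
    using I(4) by (auto simp: fun_eq_iff S_def S3 S2)
  then have "(\<integral>\<^sup>+z. f (z(i := a * z i + b * z j, j := a * z j - b * z i)) \<partial>coord_lborel I)
      = (\<integral>\<^sup>+z. f (S i j p (S j i (-b) (S i j p z))) \<partial>coord_lborel I)"
    by simp
  also have "\<dots> = (\<integral>\<^sup>+z. f (S i j p (S j i (-b) z)) \<partial>coord_lborel I)"
    using I by (intro S measurable_compose[OF S_meas] f) auto
  also have "\<dots> = (\<integral>\<^sup>+z. f (S i j p z) \<partial>coord_lborel I)"
    using I by (intro S measurable_compose[OF S_meas] f) auto
  also have "\<dots> = (\<integral>\<^sup>+z. f z \<partial>coord_lborel I)"
    using I by (intro S f) auto
  finally show ?thesis .
qed

definition cone_ball :: "'i set \<Rightarrow> real \<Rightarrow> real \<Rightarrow> ('i \<Rightarrow> real) \<Rightarrow> ('i \<Rightarrow> real) set" where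
  "cone_ball I R c x = {z \<in> space (coord_lborel I).
     L2_set z I \<le> R \<and> c * L2_set z I \<le> (\<Sum>i\<in>I. z i * x i)}"

lemma sets_cone_ball [measurable]: "cone_ball I R c x \<in> sets (coord_lborel I)"
proof -
  have "(\<lambda>z. L2_set z I) \<in> borel_measurable (coord_lborel I)"
    "(\<lambda>z. \<Sum>i\<in>I. z i * x i) \<in> borel_measurable (coord_lborel I)"
    unfolding L2_set_def
    by (auto intro!: borel_measurable_sum borel_measurable_times borel_measurable_power)
  then have "{z \<in> space (coord_lborel I). L2_set z I \<le> R} \<inter>
      {z \<in> space (coord_lborel I). c * L2_set z I \<le> (\<Sum>i\<in>I. z i * x i)} \<in> sets (coord_lborel I)"
    by (intro sets.Int borel_measurable_le borel_measurable_times borel_measurable_const)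
  then show ?thesis
    by (simp add: cone_ball_def Collect_conj_eq[symmetric] Int_def conj_ac cong: conj_cong)
qed

lemma cone_ball_cong: "(\<And>i. i \<in> I \<Longrightarrow> x i = y i) \<Longrightarrow> cone_ball I R c x = cone_ball I R c y"
  by (simp add: cone_ball_def cong: sum.cong)

text \<open>
  Rotating the plane of the coordinates \<open>i\<close> and \<open>j\<close> moves the \<open>j\<close>-component of the axis into
  its \<open>i\<close>-component and keeps norms and inner products.
\<close>

lemma emeasure_cone_ball_rotate:
  fixes x :: "'i \<Rightarrow> real"
  assumes I: "finite I" "i \<in> I" "j \<in> I" "i \<noteq> j" and "x j \<noteq> 0"
  shows "emeasure (coord_lborel I) (cone_ball I R c x)
    = emeasure (coord_lborel I) (cone_ball I R c (x(i := sqrt ((x i)\<^sup>2 + (x j)\<^sup>2), j := 0)))"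
proof -
  define r where "r = sqrt ((x i)\<^sup>2 + (x j)\<^sup>2)"
  define x' where "x' = x(i := r, j := 0)"
  have r: "r > 0" "r\<^sup>2 = (x i)\<^sup>2 + (x j)\<^sup>2"
    using \<open>x j \<noteq> 0\<close> by (auto simp: r_def add_nonneg_pos)
  define a b where "a = x i / r" and "b = x j / r"
  have ab: "a\<^sup>2 + b\<^sup>2 = 1" "b \<noteq> 0" "x i = r * a" "x j = r * b"
    using r \<open>x j \<noteq> 0\<close> by (auto simp: a_def b_def power_divide add_divide_distrib[symmetric])
  define Q where "Q = (\<lambda>z :: 'i \<Rightarrow> real. z(i := a * z i + b * z j, j := a * z j - b * z i))"
  have split: "(\<Sum>k\<in>I. F k) = F i + F j + (\<Sum>k\<in>I - {i, j}. F k)" for F :: "'i \<Rightarrow> real"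
  proof -
    have "I = {i, j} \<union> (I - {i, j})"
      using I by auto
    then have "(\<Sum>k\<in>I. F k) = (\<Sum>k\<in>{i, j}. F k) + (\<Sum>k\<in>I - {i, j}. F k)"
      using I(1) by (metis Diff_disjoint finite.emptyI finite.insertI finite_Diff sum.union_disjoint)
    then show ?thesis
      using I(4) by simp
  qed
  have norm_Q: "L2_set (Q z) I = L2_set z I" for z
  proof -
    have "(a * z i + b * z j)\<^sup>2 + (a * z j - b * z i)\<^sup>2 = (a\<^sup>2 + b\<^sup>2) * ((z i)\<^sup>2 + (z j)\<^sup>2)"
      by (simp add: power2_eq_square algebra_simps)
    then have "(\<Sum>k\<in>I. (Q z k)\<^sup>2) = (\<Sum>k\<in>I. (z k)\<^sup>2)"
      using I(4) ab(1) by (simp add: split Q_def)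
    then show ?thesis
      by (simp add: L2_set_def)
  qed
  have inner_Q: "(\<Sum>k\<in>I. Q z k * x' k) = (\<Sum>k\<in>I. z k * x k)" for z
    using I(4) by (simp add: split Q_def x'_def ab algebra_simps)
  have Q_space: "Q z \<in> space (coord_lborel I) \<longleftrightarrow> z \<in> space (coord_lborel I)"
    if "z \<in> space (coord_lborel I)" for z
    using that I by (auto simp: Q_def space_PiM PiE_def extensional_def)
  have "emeasure (coord_lborel I) (cone_ball I R c x) =
      (\<integral>\<^sup>+z. indicator (cone_ball I R c x) z \<partial>coord_lborel I)"
    by (simp add: nn_integral_indicator)
  also have "\<dots> = (\<integral>\<^sup>+z. indicator (cone_ball I R c x') (Q z) \<partial>coord_lborel I)"
    using Q_space by (intro nn_integral_cong) (auto simp: indicator_def cone_ball_def norm_Q inner_Q)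
  also have "\<dots> = (\<integral>\<^sup>+z. indicator (cone_ball I R c x') z \<partial>coord_lborel I)"
    unfolding Q_def by (rule coord_lborel_rotation[OF I ab(1,2)]) simp
  also have "\<dots> = emeasure (coord_lborel I) (cone_ball I R c x')"
    by (simp add: nn_integral_indicator)
  finally show ?thesis
    by (simp add: x'_def r_def)
qed

text \<open>
  Such rotations remove the components of the axis other than the \<open>i\<close>-th one by one. The unit
  vector that remains may point in the negative direction, and a reflection turns it around.
\<close>

lemma emeasure_cone_ball_axis:
  fixes x :: "'i \<Rightarrow> real"
  assumes I: "finite I" "i \<in> I" and x: "(\<Sum>k\<in>I. (x k)\<^sup>2) = 1"
  shows "emeasure (coord_lborel I) (cone_ball I R c x)
    = emeasure (coord_lborel I) (cone_ball I R c (\<lambda>k. of_bool (k = i)))"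
  using x
proof (induction "card {j \<in> I - {i}. x j \<noteq> 0}" arbitrary: x rule: less_induct)
  case less
  show ?case
  proof (cases "\<exists>j\<in>I - {i}. x j \<noteq> 0")
    case True
    then obtain j where j: "j \<in> I" "i \<noteq> j" "x j \<noteq> 0"
      by auto
    define x' where "x' = x(i := sqrt ((x i)\<^sup>2 + (x j)\<^sup>2), j := 0)"
    have "{k \<in> I - {i}. x' k \<noteq> 0} \<subset> {k \<in> I - {i}. x k \<noteq> 0}"
      using j by (auto simp: x'_def)
    then have "card {k \<in> I - {i}. x' k \<noteq> 0} < card {k \<in> I - {i}. x k \<noteq> 0}"
      using I(1) by (intro psubset_card_mono) auto
    moreover have "(\<Sum>k\<in>I. (x' k)\<^sup>2) = 1"
    proof -
      have split: "(\<Sum>k\<in>I. F k) = F i + (F j + (\<Sum>k\<in>I - {i} - {j}. F k))" for F :: "'i \<Rightarrow> real"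
        using I j by (simp add: sum.remove)
      show ?thesis
        using less.prems j(2) by (simp add: split x'_def)
    qed
    ultimately have "emeasure (coord_lborel I) (cone_ball I R c x')
        = emeasure (coord_lborel I) (cone_ball I R c (\<lambda>k. of_bool (k = i)))"
      by (rule less.hyps)
    then show ?thesis
      using emeasure_cone_ball_rotate[OF I j(1,2), of x R c] j(3) by (simp add: x'_def)
  next
    case False
    then have x0: "x k = 0" if "k \<in> I" "k \<noteq> i" for k
      using that by auto
    have sum_i: "(\<Sum>k\<in>I. F k) = F i" if "\<And>k. k \<in> I \<Longrightarrow> k \<noteq> i \<Longrightarrow> F k = 0" for F :: "'i \<Rightarrow> real"
      using I that by (simp add: sum.remove[of _ i])
    have "(x i)\<^sup>2 = 1"
      using less.prems sum_i[of "\<lambda>k. (x k)\<^sup>2"] x0 by simp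
    then have "x i = 1 \<or> x i = - 1"
      by (simp add: power2_eq_1_iff)
    then have xi: "\<bar>x i\<bar> = 1" "x i * x i = 1"
      by auto
    define e where "e = (\<lambda>k. of_bool (k = i) :: real)"
    have norm_upd: "L2_set (z(i := x i * z i)) I = L2_set z I" for z
      unfolding L2_set_def using xi
      by (intro arg_cong[where f = sqrt] sum.cong) (auto simp: power_mult_distrib power2_eq_square)
    have inner_upd: "(\<Sum>k\<in>I. (z(i := x i * z i)) k * e k) = (\<Sum>k\<in>I. z k * x k)" for z
      using x0 by (simp add: sum_i e_def)
    have upd_space: "z(i := y) \<in> space (coord_lborel I)" if "z \<in> space (coord_lborel I)" for z y
      using that I(2) by (auto simp: space_PiM PiE_def extensional_def)
    have "emeasure (coord_lborel I) (cone_ball I R c x) =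
        (\<integral>\<^sup>+z. indicator (cone_ball I R c x) z \<partial>coord_lborel I)"
      by (simp add: nn_integral_indicator)
    also have "\<dots> = (\<integral>\<^sup>+z. indicator (cone_ball I R c e) (z(i := 0 + x i * z i)) \<partial>coord_lborel I)"
      unfolding add_0
      by (intro nn_integral_cong)
         (auto simp del: fun_upd_apply simp: indicator_def cone_ball_def norm_upd inner_upd upd_space)
    also have "\<dots> = (\<integral>\<^sup>+z. indicator (cone_ball I R c e) z \<partial>coord_lborel I)"
      using I xi by (intro coord_lborel_shear[where h = "\<lambda>_. 0"]) auto
    also have "\<dots> = emeasure (coord_lborel I) (cone_ball I R c e)"
      by (simp add: nn_integral_indicator)
    finally show ?thesis
      by (simp add: e_def)
  qed
qed

text \<open>
  The slice of the cone at height \<open>y\<close> is a ball of dimension \<open>n\<close> whose radius is \<open>s y / c\<close> up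
  to height \<open>c R\<close>, where the cone meets the sphere, and \<open>sqrt (R^2 - y^2)\<close> above it. In the upper
  part the factor \<open>y / (c R) \<ge> 1\<close> is inserted: the integral becomes elementary, and the bound
  loses only a factor \<open>1 + o(1)\<close>, since the volume concentrates near height \<open>c R\<close>.
\<close>

lemma cone_profile_integral:
  fixes n :: nat
  assumes c: "0 < c" "c < 1" and "R > 0"
  defines "s \<equiv> sqrt (1 - c\<^sup>2)"
  shows "(\<integral>\<^sup>+y. ennreal ((s / c * y) ^ n) * indicator {0..c * R} y \<partial>lborel)
      = ennreal (s ^ n * c * R ^ Suc n / Suc n)"
    and "(\<integral>\<^sup>+y. ennreal (y / (c * R) * sqrt (R\<^sup>2 - y\<^sup>2) ^ n) * indicator {c * R..R} y \<partial>lborel)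
      = ennreal (s ^ (n + 2) * R ^ Suc n / (c * (n + 2)))"
proof -
  have c2: "c\<^sup>2 < 1"
    using c by (simp add: abs_square_less_1)
  have s: "s > 0"
    using c2 by (simp add: s_def)
  have "((\<lambda>y. (s / c * y) ^ n) has_integral
      (s / c) ^ n * (c * R) ^ Suc n / Suc n - (s / c) ^ n * 0 ^ Suc n / Suc n) {0..c * R}"
  proof (rule fundamental_theorem_of_calculus)
    show "0 \<le> c * R"
      using c \<open>R > 0\<close> by simp
    fix y
    have "((\<lambda>y. (s / c) ^ n * y ^ Suc n / Suc n) has_real_derivative (s / c * y) ^ n) (at y within {0..c * R})"
      by (auto intro!: derivative_eq_intros simp: power_mult_distrib simp del: power_Suc times_divide_eq_left times_divide_eq_right)
    then show "((\<lambda>y. (s / c) ^ n * y ^ Suc n / Suc n) has_vector_derivative (s / c * y) ^ n) (at y within {0..c * R})"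
      by (simp add: has_real_derivative_iff_has_vector_derivative)
  qed
  moreover have "(s / c) ^ n * (c * R) ^ Suc n / Suc n - (s / c) ^ n * 0 ^ Suc n / Suc n
      = s ^ n * c * R ^ Suc n / Suc n"
    using c by (simp add: power_divide power_mult_distrib)
  ultimately have "((\<lambda>y. (s / c * y) ^ n) has_integral s ^ n * c * R ^ Suc n / Suc n) {0..c * R}"
    by (simp only:)
  then show "(\<integral>\<^sup>+y. ennreal ((s / c * y) ^ n) * indicator {0..c * R} y \<partial>lborel)
      = ennreal (s ^ n * c * R ^ Suc n / Suc n)"
    using c s by (intro nn_integral_has_integral_lebesgue') auto
  define F where "F = (\<lambda>y. - (sqrt (R\<^sup>2 - y\<^sup>2) ^ (n + 2) / (c * R * (n + 2))))"
  have "((\<lambda>y. y / (c * R) * sqrt (R\<^sup>2 - y\<^sup>2) ^ n) has_integral F R - F (c * R)) {c * R..R}"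
  proof (rule fundamental_theorem_of_calculus_interior)
    show "c * R \<le> R"
      using c \<open>R > 0\<close> by simp
    show "continuous_on {c * R..R} F"
      unfolding F_def using c \<open>R > 0\<close> by (intro continuous_intros) auto
    fix y assume y: "y \<in> {c * R<..<R}"
    then have "y > 0"
      using c \<open>R > 0\<close> by (auto intro: less_trans[of 0 "c * R"])
    then have "y\<^sup>2 < R\<^sup>2"
      using y by (intro power_strict_mono) auto
    then have q: "sqrt (R\<^sup>2 - y\<^sup>2) > 0"
      by simp
    have "((\<lambda>y. sqrt (R\<^sup>2 - y\<^sup>2)) has_real_derivative - y / sqrt (R\<^sup>2 - y\<^sup>2)) (at y)"
      using \<open>y\<^sup>2 < R\<^sup>2\<close> by (auto intro!: derivative_eq_intros simp: field_simps)
    from DERIV_power[OF this, of "n + 2"]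
    have "(F has_real_derivative - (real (n + 2) * (- y / sqrt (R\<^sup>2 - y\<^sup>2) * sqrt (R\<^sup>2 - y\<^sup>2) ^ (n + 1)) / (c * R * (n + 2)))) (at y)"
      unfolding F_def by (intro DERIV_minus DERIV_cdivide) simp
    also have "- (real (n + 2) * (- y / sqrt (R\<^sup>2 - y\<^sup>2) * sqrt (R\<^sup>2 - y\<^sup>2) ^ (n + 1)) / (c * R * (n + 2)))
        = y / (c * R) * sqrt (R\<^sup>2 - y\<^sup>2) ^ n"
    proof -
      have "m * (- y / q * q ^ (n + 1)) / (c * R * m) = - (y / (c * R) * q ^ n)"
        if "q > 0" "m > 0" for q m :: real
        using that c \<open>R > 0\<close> by (simp add: field_simps)
      from this[OF q, of "real (n + 2)"] show ?thesis
        by simp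
    qed
    finally show "(F has_vector_derivative y / (c * R) * sqrt (R\<^sup>2 - y\<^sup>2) ^ n) (at y)"
      by (simp add: has_real_derivative_iff_has_vector_derivative)
  qed
  moreover have "F R - F (c * R) = s ^ (n + 2) * R ^ Suc n / (c * (n + 2))"
  proof -
    have "R\<^sup>2 - (c * R)\<^sup>2 = R\<^sup>2 * (1 - c\<^sup>2)"
      by (simp add: power_mult_distrib algebra_simps)
    then have "sqrt (R\<^sup>2 - (c * R)\<^sup>2) = R * s"
      using \<open>R > 0\<close> by (simp add: s_def real_sqrt_mult)
    moreover have "(R * s) ^ (n + 2) / (c * R * m) = s ^ (n + 2) * R ^ Suc n / (c * m)" if "m > 0" for m
      using c that \<open>R > 0\<close> by (simp add: power_mult_distrib field_simps)
    ultimately show ?thesis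
      using c \<open>R > 0\<close> by (simp add: F_def)
  qed
  ultimately have "((\<lambda>y. y / (c * R) * sqrt (R\<^sup>2 - y\<^sup>2) ^ n) has_integral
      s ^ (n + 2) * R ^ Suc n / (c * (n + 2))) {c * R..R}"
    by (simp only:)
  moreover have "0 \<le> y / (c * R) * sqrt (R\<^sup>2 - y\<^sup>2) ^ n" if "y \<in> {c * R..R}" for y
  proof -
    have "0 \<le> y"
      using that c \<open>R > 0\<close> by (auto intro: order.trans[of 0 "c * R"])
    then have "y\<^sup>2 \<le> R\<^sup>2"
      using that by (intro power_mono) auto
    then show ?thesis
      using \<open>0 \<le> y\<close> c \<open>R > 0\<close> by simp
  qed
  ultimately show "(\<integral>\<^sup>+y. ennreal (y / (c * R) * sqrt (R\<^sup>2 - y\<^sup>2) ^ n) * indicator {c * R..R} y \<partial>lborel)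
      = ennreal (s ^ (n + 2) * R ^ Suc n / (c * (n + 2)))"
    by (intro nn_integral_has_integral_lebesgue')
qed

lemma emeasure_cone_ball_axis_le:
  fixes A :: "'i set"
  assumes A: "finite A" "i \<notin> A" and c: "0 < c" "c < 1" and "R > 0"
  defines "s \<equiv> sqrt (1 - c\<^sup>2)" and "n \<equiv> card A"
  shows "emeasure (coord_lborel (insert i A)) (cone_ball (insert i A) R c (\<lambda>k. of_bool (k = i)))
    \<le> ennreal (unit_ball_vol n * R ^ Suc n * s ^ n / (c * Suc n))"
proof -
  let ?I = "insert i A"
  define e where "e = (\<lambda>k. of_bool (k = i) :: real)"
  define V where "V = unit_ball_vol n"
  define g1 where "g1 = (\<lambda>y. ennreal ((s / c * y) ^ n) * indicator {0..c * R} y)"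
  define g2 where "g2 = (\<lambda>y. ennreal (y / (c * R) * sqrt (R\<^sup>2 - y\<^sup>2) ^ n) * indicator {c * R..R} y)"
  have c2: "c\<^sup>2 < 1"
    using c by (simp add: abs_square_less_1)
  have s: "s > 0" "s\<^sup>2 = 1 - c\<^sup>2"
    using c2 by (auto simp: s_def)
  have V: "V > 0"
    by (simp add: V_def)
  define D where "D = (\<lambda>r. {w. sqrt (\<Sum>k\<in>A. (w k)\<^sup>2) \<le> r} \<inter> space (coord_lborel A))"
  have D_sets [measurable]: "D r \<in> sets (coord_lborel A)" for r
    unfolding D_def using A(1) by measurable
  have D: "emeasure (coord_lborel A) (D r) = ennreal (V * r ^ n)" if "r > 0" for r
    unfolding D_def V_def n_def using emeasure_cball_aux[OF A(1) that] by simp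
  have slice: "w \<in> space (coord_lborel A) \<and> 0 \<le> y \<and> y \<le> R \<and>
      sqrt (\<Sum>k\<in>A. (w k)\<^sup>2) \<le> sqrt (R\<^sup>2 - y\<^sup>2) \<and> sqrt (\<Sum>k\<in>A. (w k)\<^sup>2) \<le> s / c * y"
    if w: "w \<in> space (coord_lborel A)" "w(i := y) \<in> cone_ball ?I R c e" for w y
  proof -
    define q where "q = (\<Sum>k\<in>A. (w k)\<^sup>2)"
    have "q \<ge> 0"
      by (simp add: q_def sum_nonneg)
    have "(\<Sum>k\<in>?I. ((w(i := y)) k)\<^sup>2) = y\<^sup>2 + q"
      using A by (auto simp: q_def intro!: sum.cong)
    moreover have "(\<Sum>k\<in>?I. (w(i := y)) k * e k) = y"
    proof -
      have "(\<Sum>k\<in>A. (w(i := y)) k * e k) = 0"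
        using A(2) by (intro sum.neutral) (auto simp: e_def)
      then show ?thesis
        using A by (simp add: e_def)
    qed
    ultimately have 1: "sqrt (y\<^sup>2 + q) \<le> R" "c * sqrt (y\<^sup>2 + q) \<le> y"
      using w(2) unfolding cone_ball_def L2_set_def by auto
    have "y \<ge> 0"
      using 1(2) c \<open>q \<ge> 0\<close> by (smt (verit) mult_nonneg_nonneg real_sqrt_ge_zero zero_le_power2)
    have "y\<^sup>2 + q \<le> R\<^sup>2"
      using 1(1) \<open>R > 0\<close> by (simp add: real_sqrt_le_iff' \<open>q \<ge> 0\<close>)
    then have "y \<le> R" "sqrt q \<le> sqrt (R\<^sup>2 - y\<^sup>2)"
      using \<open>q \<ge> 0\<close> \<open>R > 0\<close> by (auto intro: power2_le_imp_le)
    moreover have "sqrt q \<le> s / c * y"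
    proof -
      have "(c * sqrt (y\<^sup>2 + q))\<^sup>2 \<le> y\<^sup>2"
        using 1(2) c \<open>q \<ge> 0\<close> by (intro power_mono) auto
      then have "c\<^sup>2 * (y\<^sup>2 + q) \<le> y\<^sup>2"
        using \<open>q \<ge> 0\<close> by (simp add: power_mult_distrib)
      then have "c\<^sup>2 * q \<le> s\<^sup>2 * y\<^sup>2"
        by (simp add: s(2) algebra_simps)
      then have "q \<le> (s / c * y)\<^sup>2"
        using c by (simp add: power_mult_distrib power_divide field_simps)
      then show ?thesis
        using \<open>y \<ge> 0\<close> s c by (simp add: real_sqrt_le_iff' \<open>q \<ge> 0\<close>)
    qed
    ultimately show ?thesis
      using w(1) \<open>y \<ge> 0\<close> by (simp add: q_def)
  qed
  \<comment> \<open>at the two excluded heights, which form a null set, the ball in the slice is a single point\<close>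
  have bound: "(\<integral>\<^sup>+w. indicator (cone_ball ?I R c e) (w(i := y)) \<partial>coord_lborel A) \<le> ennreal V * (g1 y + g2 y)"
    if y: "y \<noteq> 0" "y \<noteq> R" for y
  proof (cases "0 < y \<and> y < R")
    case False
    then have "(\<integral>\<^sup>+w. indicator (cone_ball ?I R c e) (w(i := y)) \<partial>coord_lborel A) = (\<integral>\<^sup>+w. 0 \<partial>coord_lborel A)"
      using slice[of _ y] y by (intro nn_integral_cong) (force simp: indicator_def)
    then show ?thesis
      by simp
  next
    case True
    have sub: "(\<integral>\<^sup>+w. indicator (cone_ball ?I R c e) (w(i := y)) \<partial>coord_lborel A)
        \<le> (\<integral>\<^sup>+w. indicator (D r) w \<partial>coord_lborel A)"
      if "r \<in> {sqrt (R\<^sup>2 - y\<^sup>2), s / c * y}" for r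
      using slice[of _ y] that by (intro nn_integral_mono) (auto simp: indicator_def D_def)
    show ?thesis
    proof (cases "y \<le> c * R")
      case y_small: True
      have "(\<integral>\<^sup>+w. indicator (D (s / c * y)) w \<partial>coord_lborel A) = ennreal (V * (s / c * y) ^ n)"
        using D[of "s / c * y"] True c s by (simp add: nn_integral_indicator)
      also have "\<dots> = ennreal V * g1 y"
        using True y_small V by (simp add: g1_def ennreal_mult')
      also have "\<dots> \<le> ennreal V * (g1 y + g2 y)"
        by (intro mult_left_mono) auto
      finally show ?thesis
        using sub[of "s / c * y"] by simp
    next
      case False
      have q: "R\<^sup>2 - y\<^sup>2 > 0"
        using True by (simp add: power_strict_mono)
      then have "(\<integral>\<^sup>+w. indicator (D (sqrt (R\<^sup>2 - y\<^sup>2))) w \<partial>coord_lborel A) = ennreal (V * sqrt (R\<^sup>2 - y\<^sup>2) ^ n)"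
        using D[of "sqrt (R\<^sup>2 - y\<^sup>2)"] by (simp add: nn_integral_indicator)
      also have "\<dots> \<le> ennreal (V * (y / (c * R) * sqrt (R\<^sup>2 - y\<^sup>2) ^ n))"
      proof -
        have "1 \<le> y / (c * R)"
          using False c \<open>R > 0\<close> by (simp add: field_simps)
        from mult_right_mono[OF this, of "sqrt (R\<^sup>2 - y\<^sup>2) ^ n"] show ?thesis
          using V q by (intro ennreal_leI mult_left_mono) auto
      qed
      also have "\<dots> = ennreal V * g2 y"
        using True False V by (simp add: g2_def ennreal_mult' del: times_divide_eq_left times_divide_eq_right)
      also have "\<dots> \<le> ennreal V * (g1 y + g2 y)"
        by (intro mult_left_mono) auto
      finally show ?thesis
        using sub[of "sqrt (R\<^sup>2 - y\<^sup>2)"] by simp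
    qed
  qed
  have "emeasure (coord_lborel ?I) (cone_ball ?I R c e) = (\<integral>\<^sup>+z. indicator (cone_ball ?I R c e) z \<partial>coord_lborel ?I)"
    by (simp add: nn_integral_indicator)
  also have "\<dots> = (\<integral>\<^sup>+y. (\<integral>\<^sup>+w. indicator (cone_ball ?I R c e) (w(i := y)) \<partial>coord_lborel A) \<partial>lborel)"
    by (subst coord.product_nn_integral_insert_rev[OF A]) simp_all
  also have "\<dots> \<le> (\<integral>\<^sup>+y. ennreal V * (g1 y + g2 y) \<partial>lborel)"
  proof (rule nn_integral_mono_AE)
    have "AE y in lborel. y \<notin> {0, R}"
      by (intro AE_not_in countable_imp_null_set_lborel) auto
    then show "AE y in lborel. (\<integral>\<^sup>+w. indicator (cone_ball ?I R c e) (w(i := y)) \<partial>coord_lborel A) \<le> ennreal V * (g1 y + g2 y)"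
      by eventually_elim (auto intro!: bound)
  qed
  also have "\<dots> = ennreal V * (ennreal (s ^ n * c * R ^ Suc n / Suc n) + ennreal (s ^ (n + 2) * R ^ Suc n / (c * (n + 2))))"
    using cone_profile_integral[OF c \<open>R > 0\<close>, of n]
    by (simp add: nn_integral_cmult nn_integral_add g1_def g2_def s_def)
  also have "\<dots> = ennreal (V * (s ^ n * c * R ^ Suc n / Suc n + s ^ (n + 2) * R ^ Suc n / (c * (n + 2))))"
    using V s c \<open>R > 0\<close> by (subst ennreal_plus[symmetric]) (auto simp: ennreal_mult')
  also have "\<dots> \<le> ennreal (V * R ^ Suc n * s ^ n / (c * Suc n))"
  proof (rule ennreal_leI)
    have "s ^ (n + 2) * R ^ Suc n / (c * (n + 2)) \<le> s ^ (n + 2) * R ^ Suc n / (c * Suc n)"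
      using s c \<open>R > 0\<close> by (intro divide_left_mono mult_left_mono) auto
    then have "V * (s ^ n * c * R ^ Suc n / Suc n + s ^ (n + 2) * R ^ Suc n / (c * (n + 2)))
        \<le> V * (s ^ n * c * R ^ Suc n / Suc n + s ^ (n + 2) * R ^ Suc n / (c * Suc n))"
      using V by (intro mult_left_mono add_left_mono) auto
    also have "\<dots> = V * R ^ Suc n * s ^ n * (c\<^sup>2 + s\<^sup>2) / (c * Suc n)"
    proof -
      have "V * (p * c * q / m + p * s\<^sup>2 * q / (c * m)) = V * q * p * (c\<^sup>2 + s\<^sup>2) / (c * m)"
        if "m > 0" for p q m :: real
        using c that by (simp add: field_simps power2_eq_square)
      from this[of "real (Suc n)" "s ^ n" "R ^ Suc n"] show ?thesis
        by (simp only: power_add)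
    qed
    finally show "V * (s ^ n * c * R ^ Suc n / Suc n + s ^ (n + 2) * R ^ Suc n / (c * (n + 2)))
        \<le> V * R ^ Suc n * s ^ n / (c * Suc n)"
      by (simp add: s(2))
  qed
  finally show ?thesis
    by (simp add: V_def e_def)
qed

text \<open>
  For a cone with half-angle \<open>\<theta>\<close> this is the proportion \<open>sin \<theta> ^ n / (cos \<theta> * (n + 1))\<close>, times
  the ratio of two unit ball volumes, of the whole ball. It is asymptotically sharp, as the
  constant in the final bound requires.
\<close>

lemma emeasure_cone_ball_le:
  fixes x :: "'i \<Rightarrow> real"
  assumes I: "finite I" "card I = Suc n" and x: "(\<Sum>k\<in>I. (x k)\<^sup>2) = 1"
    and c: "0 < c" "c < 1" and "R > 0"
  shows "emeasure (coord_lborel I) (cone_ball I R c x)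
    \<le> ennreal (unit_ball_vol n * R ^ Suc n * sqrt (1 - c\<^sup>2) ^ n / (c * Suc n))"
proof -
  obtain i A where A: "I = insert i A" "i \<notin> A" "card A = n"
    using I(2) by (metis card_Suc_eq)
  then show ?thesis
    using emeasure_cone_ball_axis[OF I(1) _ x, of i R c] emeasure_cone_ball_axis_le[of A i c R] c \<open>R > 0\<close> I(1)
    by simp
qed

section \<open>Lattice points in shells and cones\<close>

definition lattice_floor :: "nat \<Rightarrow> (nat \<Rightarrow> real) \<Rightarrow> nat \<Rightarrow> real" where
  "lattice_floor d z = (\<lambda>i\<in>{..<d}. of_int \<lfloor>z i\<rfloor>)"

definition lattice_shell :: "nat \<Rightarrow> real \<Rightarrow> real \<Rightarrow> (nat \<Rightarrow> real) set" where
  "lattice_shell d \<rho> R = {p \<in> {..<d} \<rightarrow>\<^sub>E \<int>. \<rho> \<le> L2_set p {..<d} \<and> L2_set p {..<d} \<le> R}"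

lemma finite_lattice_shell: "finite (lattice_shell d \<rho> R)"
proof (rule finite_subset)
  show "lattice_shell d \<rho> R \<subseteq> {..<d} \<rightarrow>\<^sub>E (of_int ` {- \<lceil>R\<rceil>..\<lceil>R\<rceil>})"
  proof
    fix p assume p: "p \<in> lattice_shell d \<rho> R"
    have "p i \<in> of_int ` {- \<lceil>R\<rceil>..\<lceil>R\<rceil>}" if i: "i < d" for i
    proof -
      have "\<bar>p i\<bar> \<le> R"
        using member_le_L2_set[of "{..<d}" i "\<lambda>i. \<bar>p i\<bar>"] p that
        by (simp add: lattice_shell_def L2_set_def)
      moreover obtain k where "p i = of_int k"
        using p i Ints_cases[of "p i" thesis] by (auto simp: lattice_shell_def PiE_iff)
      ultimately show ?thesis
        by (intro image_eqI[of _ _ k]) (auto, linarith+)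
    qed
    then show "p \<in> {..<d} \<rightarrow>\<^sub>E (of_int ` {- \<lceil>R\<rceil>..\<lceil>R\<rceil>})"
      using p by (auto simp: lattice_shell_def PiE_def)
  qed
qed (intro finite_PiE, auto)

text \<open>
  The points that round down to a given lattice point form a unit cube, so counting lattice
  points is measuring.
\<close>

lemma lattice_floor_cells:
  assumes "finite W" "W \<subseteq> {..<d} \<rightarrow>\<^sub>E \<int>"
  shows "{z \<in> space (coord_lborel {..<d}). lattice_floor d z \<in> W} \<in> sets (coord_lborel {..<d})"
    and "emeasure (coord_lborel {..<d}) {z \<in> space (coord_lborel {..<d}). lattice_floor d z \<in> W} = card W"
proof -
  let ?M = "coord_lborel {..<d}"
  define cell where "cell = (\<lambda>p. {z \<in> space ?M. lattice_floor d z = p})"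
  have cell: "cell p = (\<Pi>\<^sub>E i\<in>{..<d}. {p i..<p i + 1})" if "p \<in> W" for p
  proof -
    have p: "p \<in> {..<d} \<rightarrow>\<^sub>E \<int>"
      using that assms(2) by auto
    have "lattice_floor d z = p \<longleftrightarrow> (\<forall>i<d. z i \<in> {p i..<p i + 1})" for z
    proof -
      have "lattice_floor d z = p \<longleftrightarrow> (\<forall>i<d. of_int \<lfloor>z i\<rfloor> = p i)"
        using p by (auto simp: lattice_floor_def fun_eq_iff PiE_def extensional_def)
      also have "\<dots> \<longleftrightarrow> (\<forall>i<d. z i \<in> {p i..<p i + 1})"
      proof (intro all_cong)
        fix i assume "i < d"
        then obtain k where "p i = of_int k"
          using p Ints_cases[of "p i" thesis] by (auto simp: PiE_iff)
        then show "of_int \<lfloor>z i\<rfloor> = p i \<longleftrightarrow> z i \<in> {p i..<p i + 1}"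
          by (auto simp: floor_eq_iff)
      qed
      finally show ?thesis .
    qed
    then show ?thesis
      by (auto simp: cell_def space_PiM PiE_def Pi_def)
  qed
  have sets: "cell p \<in> sets ?M" if "p \<in> W" for p
    unfolding cell[OF that] by (intro sets_PiM_I_finite) auto
  have one: "emeasure ?M (cell p) = 1" if "p \<in> W" for p
    unfolding cell[OF that] by (subst coord.emeasure_PiM) auto
  have eq: "{z \<in> space ?M. lattice_floor d z \<in> W} = (\<Union>p\<in>W. cell p)"
    by (auto simp: cell_def)
  show "{z \<in> space ?M. lattice_floor d z \<in> W} \<in> sets ?M"
    unfolding eq using assms(1) sets by auto
  have "emeasure ?M (\<Union>p\<in>W. cell p) = (\<Sum>p\<in>W. emeasure ?M (cell p))"
    using assms(1) sets
    by (intro sum_emeasure[symmetric]) (auto simp: disjoint_family_on_def cell_def)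
  then show "emeasure ?M {z \<in> space ?M. lattice_floor d z \<in> W} = card W"
    by (simp add: eq one)
qed

lemma L2_set_lattice_floor:
  "\<bar>L2_set z {..<d} - L2_set (lattice_floor d z) {..<d}\<bar> \<le> sqrt d"
  "L2_set (\<lambda>i. z i - lattice_floor d z i) {..<d} \<le> sqrt d"
proof -
  let ?p = "lattice_floor d z"
  have p: "0 \<le> z i - ?p i" "z i - ?p i \<le> 1" if "i < d" for i
    using that by (auto simp: lattice_floor_def) linarith
  have "L2_set (\<lambda>i. z i - ?p i) {..<d} \<le> L2_set (\<lambda>i. 1) {..<d}"
    using p by (intro L2_set_mono) auto
  then show 1: "L2_set (\<lambda>i. z i - ?p i) {..<d} \<le> sqrt d"
    by (simp add: L2_set_def)
  have "L2_set z {..<d} \<le> L2_set (\<lambda>i. z i - ?p i) {..<d} + L2_set ?p {..<d}"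
    using L2_set_triangle_ineq[of "\<lambda>i. z i - ?p i" ?p "{..<d}"] by simp
  moreover have "L2_set ?p {..<d} \<le> L2_set (\<lambda>i. ?p i - z i) {..<d} + L2_set z {..<d}"
    using L2_set_triangle_ineq[of "\<lambda>i. ?p i - z i" z "{..<d}"] by simp
  moreover have "L2_set (\<lambda>i. ?p i - z i) {..<d} = L2_set (\<lambda>i. z i - ?p i) {..<d}"
    by (simp add: L2_set_def power2_commute)
  ultimately show "\<bar>L2_set z {..<d} - L2_set ?p {..<d}\<bar> \<le> sqrt d"
    using 1 by linarith
qed

text \<open>
  Rounding down changes the norm by at most \<open>sqrt d\<close>, so a point of the smaller ball that does
  not round into the shell lies close to the excised core.
\<close>

lemma card_lattice_shell_ge:
  assumes "0 < \<rho>" "sqrt d < R"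
  shows "unit_ball_vol d * (R - sqrt d) ^ d \<le> card (lattice_shell d \<rho> R) + unit_ball_vol d * (\<rho> + sqrt d) ^ d"
proof -
  let ?M = "coord_lborel {..<d}" and ?V = "lattice_shell d \<rho> R"
  define B where "B = (\<lambda>r. {z. sqrt (\<Sum>i<d. (z i)\<^sup>2) \<le> r} \<inter> space ?M)"
  have B_sets [measurable]: "B r \<in> sets ?M" for r
    unfolding B_def by measurable
  have B: "emeasure ?M (B r) = ennreal (unit_ball_vol d * r ^ d)" if "r > 0" for r
    unfolding B_def using emeasure_cball_aux[of "{..<d}" r] that by simp
  have V: "?V \<subseteq> {..<d} \<rightarrow>\<^sub>E \<int>"
    by (auto simp: lattice_shell_def)
  let ?C = "{z \<in> space ?M. lattice_floor d z \<in> ?V}"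
  have "B (R - sqrt d) \<subseteq> ?C \<union> B (\<rho> + sqrt d)"
  proof
    fix z assume z: "z \<in> B (R - sqrt d)"
    show "z \<in> ?C \<union> B (\<rho> + sqrt d)"
    proof (cases "L2_set z {..<d} \<le> \<rho> + sqrt d")
      case True
      then show ?thesis
        using z by (simp add: B_def L2_set_def)
    next
      case False
      then have "lattice_floor d z \<in> ?V"
        using z L2_set_lattice_floor(1)[of z d]
        by (auto simp: lattice_shell_def lattice_floor_def[of d z] B_def L2_set_def[symmetric])
      then show ?thesis
        using z by (simp add: B_def)
    qed
  qed
  then have "emeasure ?M (B (R - sqrt d)) \<le> emeasure ?M (?C \<union> B (\<rho> + sqrt d))"
    using lattice_floor_cells(1)[OF finite_lattice_shell V] by (intro emeasure_mono) auto
  also have "\<dots> \<le> emeasure ?M ?C + emeasure ?M (B (\<rho> + sqrt d))"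
    using lattice_floor_cells(1)[OF finite_lattice_shell V] by (intro emeasure_subadditive) auto
  also have "emeasure ?M ?C = ennreal (card ?V)"
    by (simp add: lattice_floor_cells(2)[OF finite_lattice_shell V] ennreal_of_nat_eq_real_of_nat)
  finally show ?thesis
    using B[of "R - sqrt d"] B[of "\<rho> + sqrt d"] assms
    by (simp add: add_pos_nonneg ennreal_plus[symmetric] del: ennreal_plus)
qed

text \<open>
  Rounding changes the inner product with \<open>x\<close> and the norm by at most \<open>sqrt d\<close>. Away from the
  core this is a small part \<open>\<delta>\<close> of the norm, so the unit cubes at the lattice points of a cone lie
  in a slightly wider cone.
\<close>

lemma card_lattice_cone_le:
  fixes c \<delta> \<rho> R c' :: real
  assumes x: "(\<Sum>k<Suc n. (x k)\<^sup>2) = 1" and "0 < \<delta>" "\<delta> < c" "c < 1"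
    and \<rho>: "2 * sqrt (Suc n) \<le> \<delta> * (\<rho> - sqrt (Suc n))" and "0 < R"
  defines "c' \<equiv> c - \<delta>"
  shows "card {p \<in> lattice_shell (Suc n) \<rho> R. c * L2_set p {..<Suc n} \<le> euclid_inner (Suc n) p x}
    \<le> unit_ball_vol n * (R + sqrt (Suc n)) ^ Suc n * sqrt (1 - c'\<^sup>2) ^ n / (c' * Suc n)"
proof -
  define d where "d = Suc n"
  let ?M = "coord_lborel {..<d}"
  let ?r = "sqrt (Suc n)"
  define W where "W = {p \<in> lattice_shell d \<rho> R. c * L2_set p {..<d} \<le> euclid_inner d p x}"
  have W: "W \<subseteq> {..<d} \<rightarrow>\<^sub>E \<int>" "finite W"
    by (auto simp: W_def lattice_shell_def intro: finite_subset[OF _ finite_lattice_shell[of d \<rho> R]])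
  have x1: "L2_set x {..<d} = 1"
    using x by (simp add: d_def L2_set_def)
  have "{z \<in> space ?M. lattice_floor d z \<in> W} \<subseteq> cone_ball {..<d} (R + ?r) c' x"
  proof safe
    fix z assume z: "z \<in> space ?M" and "lattice_floor d z \<in> W"
    let ?p = "lattice_floor d z"
    have p: "\<rho> \<le> L2_set ?p {..<d}" "L2_set ?p {..<d} \<le> R" "c * L2_set ?p {..<d} \<le> euclid_inner d ?p x"
      using \<open>?p \<in> W\<close> by (auto simp: W_def lattice_shell_def)
    have near: "\<bar>L2_set z {..<d} - L2_set ?p {..<d}\<bar> \<le> ?r"
      using L2_set_lattice_floor(1)[of z d] by (simp add: d_def)
    have "\<bar>\<Sum>i<d. (z i - ?p i) * x i\<bar> \<le> (\<Sum>i<d. \<bar>z i - ?p i\<bar> * \<bar>x i\<bar>)"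
      by (rule order.trans[OF sum_abs]) (simp add: abs_mult)
    also have "\<dots> \<le> L2_set (\<lambda>i. z i - ?p i) {..<d} * L2_set x {..<d}"
      by (rule L2_set_mult_ineq)
    also have "\<dots> \<le> ?r"
      unfolding x1 using L2_set_lattice_floor(2)[of z d] by (simp add: d_def)
    finally have "euclid_inner d ?p x - ?r \<le> (\<Sum>i<d. z i * x i)"
      by (simp add: euclid_inner_def left_diff_distrib sum_subtractf)
    moreover have "c * L2_set z {..<d} \<le> c * (L2_set ?p {..<d} + ?r)"
      using near assms by (intro mult_left_mono) auto
    moreover have "c * ?r \<le> 1 * ?r"
      using assms by (intro mult_right_mono) auto
    moreover have "\<delta> * (\<rho> - ?r) \<le> \<delta> * L2_set z {..<d}"
      using near p(1) \<open>0 < \<delta>\<close> by (intro mult_left_mono) linarith+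
    ultimately have "c' * L2_set z {..<d} \<le> (\<Sum>i<d. z i * x i)"
      using p(3) \<rho> unfolding c'_def by (simp only: distrib_left left_diff_distrib)
    then show "z \<in> cone_ball {..<d} (R + ?r) c' x"
      using z near p(2) by (simp add: cone_ball_def)
  qed
  then have "emeasure ?M {z \<in> space ?M. lattice_floor d z \<in> W} \<le> emeasure ?M (cone_ball {..<d} (R + ?r) c' x)"
    by (intro emeasure_mono sets_cone_ball)
  also have "\<dots> \<le> ennreal (unit_ball_vol n * (R + ?r) ^ Suc n * sqrt (1 - c'\<^sup>2) ^ n / (c' * Suc n))"
    using assms by (intro emeasure_cone_ball_le) (auto simp: d_def add_pos_nonneg)
  finally have "ennreal (card W) \<le> ennreal (unit_ball_vol n * (R + ?r) ^ Suc n * sqrt (1 - c'\<^sup>2) ^ n / (c' * Suc n))"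
    by (simp add: lattice_floor_cells(2)[OF W(2,1)] ennreal_of_nat_eq_real_of_nat)
  moreover have "c'\<^sup>2 \<le> 1"
    using assms by (intro power_le_one) auto
  ultimately show ?thesis
    using assms by (subst (asm) ennreal_le_iff) (auto simp: W_def d_def)
qed

section \<open>The graph of narrow angles\<close>

text \<open>
  Two vectors are related if the angle between them is less than \<open>\<pi>/3\<close>. Equality is included
  because a closed, hence reflexive, relation is needed also at the zero vector.
\<close>

definition narrow_angle :: "nat \<Rightarrow> (nat \<Rightarrow> real) \<Rightarrow> (nat \<Rightarrow> real) \<Rightarrow> bool" where
  "narrow_angle d p q \<longleftrightarrow> p = q \<or> L2_set p {..<d} * L2_set q {..<d} / 2 < euclid_inner d p q"

lemma euclid_inner_commute: "euclid_inner d x y = euclid_inner d y x"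
  by (simp add: euclid_inner_def mult.commute)

lemma euclid_inner_self: "euclid_inner d x x = (L2_set x {..<d})\<^sup>2"
  by (simp add: euclid_inner_def L2_set_def power2_eq_square sum_nonneg)

lemma reflp_narrow_angle: "reflp (narrow_angle d)"
  by (simp add: reflp_def narrow_angle_def)

lemma symp_narrow_angle: "symp (narrow_angle d)"
  by (auto simp: symp_def narrow_angle_def euclid_inner_commute mult.commute)

text \<open>
  Scaled to norm \<open>2\<close>, independent vectors become centres of unit spheres that touch the central
  one and do not overlap. The scaling is injective, since vectors of equal direction are adjacent.
\<close>

lemma card_independent_le_kissing_number:
  assumes I: "I \<in> independent_sets (narrow_angle d) S" "finite S" and pos: "\<And>p. p \<in> S \<Longrightarrow> L2_set p {..<d} > 0"
  shows "card I \<le> kissing_number d"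
proof -
  let ?N = "\<lambda>p. L2_set p {..<d}"
  define g where "g = (\<lambda>p. \<lambda>i\<in>{..<d}. 2 / ?N p * p i)"
  have fin: "finite I" and posI: "\<And>p. p \<in> I \<Longrightarrow> ?N p > 0"
    using I pos by (auto simp: independent_sets_def finite_subset)
  have inner: "euclid_inner d (g p) (g q) = 4 * euclid_inner d p q / (?N p * ?N q)" for p q
    unfolding euclid_inner_def sum_distrib_left sum_divide_distrib
    by (intro sum.cong) (auto simp: g_def)
  have norm: "euclid_inner d (g p) (g p) = 4" if "p \<in> I" for p
    using posI[OF that] by (subst inner) (simp add: euclid_inner_self power2_eq_square)
  have dist: "2 \<le> euclid_dist d (g p) (g q)" if "p \<in> I" "q \<in> I" "p \<noteq> q" for p q
  proof -
    have "\<not> narrow_angle d p q"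
      using that I by (auto simp: independent_sets_def)
    then have "euclid_inner d p q \<le> ?N p * ?N q / 2"
      by (simp add: narrow_angle_def)
    then have "euclid_inner d (g p) (g q) \<le> 2"
      using posI[OF that(1)] posI[OF that(2)] by (simp add: inner field_simps)
    then have "2\<^sup>2 \<le> (euclid_dist d (g p) (g q))\<^sup>2"
      using norm that by (simp add: euclid_dist_power2)
    then show ?thesis
      by (rule power2_le_imp_le) (simp add: euclid_dist_def)
  qed
  have inj: "inj_on g I"
  proof (rule inj_onI, rule ccontr)
    fix p q assume "p \<in> I" "q \<in> I" "g p = g q" "p \<noteq> q"
    with dist[of p q] show False
      by (simp add: euclid_dist_def L2_set_def)
  qed
  have "L2_set (g p) {..<d} = 2" if "p \<in> I" for p
    using norm[OF that] L2_set_nonneg[of "g p" "{..<d}"]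
    by (simp add: euclid_inner_self power2_eq_iff[of _ 2, simplified])
  moreover have "g p \<in> euclid d" for p
    by (simp add: g_def euclid_def)
  ultimately have "kissing_configuration d (g ` I)"
    using fin dist by (auto simp: kissing_configuration_iff pairwise_def)
  from kissing_number_ge[OF this] show ?thesis
    by (simp add: card_image[OF inj])
qed

text \<open>
  Every related pair can be oriented towards larger \<open>t\<close>. It thus suffices to bound, for each
  \<open>x\<close>, the number of related points that \<open>t\<close> ranks at least as high as \<open>x\<close>.
\<close>

lemma sum_card_related_le:
  fixes t :: "'a \<Rightarrow> real"
  assumes T: "finite T" and E: "symp E"
    and k: "\<And>x. x \<in> T \<Longrightarrow> real (card {y \<in> T. E x y \<and> t x \<le> t y}) \<le> k"
  shows "(\<Sum>x\<in>T. real (card {y \<in> T. E x y})) \<le> 2 * k * real (card T)"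
proof -
  have card_eq: "real (card {y \<in> T. P y}) = (\<Sum>y\<in>T. of_bool (P y))" for P
    using T by (simp add: of_bool_def sum.If_cases Int_def)
  have "(\<Sum>x\<in>T. real (card {y \<in> T. E x y})) = (\<Sum>x\<in>T. \<Sum>y\<in>T. of_bool (E x y))"
    by (simp only: card_eq)
  also have "\<dots> \<le> (\<Sum>x\<in>T. \<Sum>y\<in>T. of_bool (E x y \<and> t x \<le> t y) + of_bool (E y x \<and> t y \<le> t x))"
    using sympD[OF E] by (intro sum_mono) auto
  also have "\<dots> = (\<Sum>x\<in>T. \<Sum>y\<in>T. of_bool (E x y \<and> t x \<le> t y)) + (\<Sum>y\<in>T. \<Sum>x\<in>T. of_bool (E y x \<and> t y \<le> t x))"
    by (simp add: sum.distrib) (rule sum.swap)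
  also have "\<dots> = 2 * (\<Sum>x\<in>T. real (card {y \<in> T. E x y \<and> t x \<le> t y}))"
    by (simp only: card_eq)
  also have "\<dots> \<le> 2 * (\<Sum>x\<in>T. k)"
    using k by (intro mult_left_mono sum_mono) auto
  finally show ?thesis
    by (simp add: mult_ac)
qed

text \<open>
  The cap around \<open>u\<close> of angular radius \<open>\<pi>/3\<close> and the cap around \<open>v\<close> with \<open>u\<close> on its boundary
  intersect in a lens. A cap of angular radius \<open>arccos (1 / sqrt 3)\<close> around the midpoint \<open>m\<close> of
  \<open>u\<close> and \<open>v\<close> covers it. The extreme case is an angle of \<open>\<pi>/3\<close> between \<open>u\<close> and \<open>v\<close>, where
  each common boundary point of the two caps forms an equilateral triangle with \<open>u\<close> and \<open>v\<close>.
\<close>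

lemma lens_in_cone:
  assumes u: "euclid_inner d u u = 1" and v: "euclid_inner d v v = 1"
    and t: "1 / 2 \<le> euclid_inner d u v"
  obtains m where "euclid_inner d m m = 1"
    "\<And>p r. \<lbrakk>0 \<le> r; r / 2 \<le> euclid_inner d p u; r * euclid_inner d u v \<le> euclid_inner d p v\<rbrakk>
      \<Longrightarrow> r / sqrt 3 \<le> euclid_inner d p m"
proof -
  define t where "t = euclid_inner d u v"
  define w where "w = sqrt (2 + 2 * t)"
  have "2 + 2 * t > 0"
    using t by (simp add: t_def)
  then have w: "w > 0" "w\<^sup>2 = 2 + 2 * t"
    by (auto simp: w_def)
  define m where "m = (\<lambda>i. (u i + v i) / w)"
  have inner_m: "euclid_inner d p m = (euclid_inner d p u + euclid_inner d p v) / w" for p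
    by (simp add: euclid_inner_def m_def sum_divide_distrib[symmetric] sum.distrib[symmetric] algebra_simps)
  have "euclid_inner d m m = (euclid_inner d u m + euclid_inner d v m) / w"
    by (subst inner_m) (simp add: euclid_inner_commute)
  also have "\<dots> = 1"
    using w u v \<open>2 + 2 * t > 0\<close> by (simp add: inner_m euclid_inner_commute[of d v u] t_def[symmetric] power2_eq_square add_divide_distrib[symmetric])
  finally have "euclid_inner d m m = 1" .
  moreover have "r / sqrt 3 \<le> euclid_inner d p m"
    if "0 \<le> r" "r / 2 \<le> euclid_inner d p u" "r * euclid_inner d u v \<le> euclid_inner d p v" for p r
  proof -
    have "w / sqrt 3 \<le> 1 / 2 + t"
    proof (rule power2_le_imp_le)
      \<comment> \<open>the squared inequality is \<open>3 t^2 + t - 5/4 \<ge> 0\<close>, with root \<open>t = 1/2\<close>\<close>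
      have "0 \<le> (t - 1 / 2) * (3 * t + 5 / 2)"
        using t by (intro mult_nonneg_nonneg) (auto simp: t_def)
      moreover have "(w / sqrt 3)\<^sup>2 = (2 + 2 * t) / 3"
        by (simp add: power_divide w(2))
      ultimately show "(w / sqrt 3)\<^sup>2 \<le> (1 / 2 + t)\<^sup>2"
        by (simp add: power2_eq_square field_simps)
    qed (use t in \<open>simp add: t_def\<close>)
    then have "r * (w / sqrt 3) \<le> r * (1 / 2 + t)"
      using that(1) by (rule mult_left_mono)
    also have "\<dots> \<le> euclid_inner d p u + euclid_inner d p v"
      using that by (simp add: t_def algebra_simps)
    finally show ?thesis
      using w by (simp add: inner_m field_simps)
  qed
  ultimately show ?thesis
    by (rule that)
qed

definition cone_volume_bound :: "nat \<Rightarrow> real \<Rightarrow> real" where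
  "cone_volume_bound n c = unit_ball_vol n * sqrt (1 - c\<^sup>2) ^ n / (c * Suc n)"

lemma cone_volume_bound_pos: "0 < c \<Longrightarrow> c < 1 \<Longrightarrow> 0 < cone_volume_bound n c"
  by (simp add: cone_volume_bound_def abs_square_less_1)

text \<open>
  The independent set theorem for the lattice points of a shell: \<open>A\<close> and \<open>B\<close> are the bounds
  for the degrees and for the local average degrees, up to the common factor
  \<open>(R + sqrt d) ^ d\<close>. Taking \<open>\<phi> = 1 / (K d)\<close> and \<open>exp z = A / (B d^2)\<close> makes the two error
  terms \<open>exp (\<phi> K)\<close> and \<open>exp z / (\<phi> \<Delta>)\<close> equal to \<open>exp (1 / d)\<close> and \<open>1 / d\<close>.
\<close>

lemma kissing_number_lattice_bound:
  fixes n :: nat and \<delta> \<rho> R :: real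
  assumes "0 < \<delta>" "\<delta> < 1 / 2" and \<rho>: "2 * sqrt (Suc n) \<le> \<delta> * (\<rho> - sqrt (Suc n))" and "0 < R"
  defines "A \<equiv> cone_volume_bound n (1 / 2 - \<delta>)" and "B \<equiv> 2 * cone_volume_bound n (1 / sqrt 3 - \<delta>)"
    and "d \<equiv> Suc n"
  shows "(1 + ln (A / (B * (real d)\<^sup>2))) * real (card (lattice_shell d \<rho> R))
    \<le> A * (R + sqrt d) ^ d * (exp (1 / d) + 1 / d) * real (kissing_number d)"
proof -
  let ?N = "\<lambda>p. L2_set p {..<d}" and ?E = "narrow_angle d" and ?S = "lattice_shell d \<rho> R"
  define X where "X = (R + sqrt d) ^ d"
  define \<Delta> K where "\<Delta> = A * X" and "K = B * X"
  have d: "real d > 0"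
    by (simp add: d_def)
  have s3: "1 / 2 < 1 / sqrt 3" "1 / sqrt 3 < 1"
  proof -
    have "sqrt 3 < 2"
      by (rule real_less_lsqrt) auto
    moreover have "1 < sqrt 3"
      by simp
    ultimately show "1 / 2 < 1 / sqrt 3" "1 / sqrt 3 < 1"
      by (simp_all add: field_simps)
  qed
  have A: "A > 0"
    unfolding A_def using assms(1,2) by (intro cone_volume_bound_pos) auto
  have B: "B > 0"
    unfolding B_def using assms(1,2) s3 by (intro mult_pos_pos cone_volume_bound_pos; linarith)
  have X: "X > 0"
    using \<open>0 < R\<close> by (simp add: X_def add_pos_nonneg)
  have \<Delta>: "\<Delta> > 0" and K: "K > 0"
    using A B X by (auto simp: \<Delta>_def K_def)
  have "\<rho> > 0"
  proof -
    have "0 < \<delta> * (\<rho> - sqrt (Suc n))"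
      by (rule less_le_trans[OF _ \<rho>]) simp
    then have "sqrt (Suc n) < \<rho>"
      using \<open>0 < \<delta>\<close> by (simp add: zero_less_mult_iff)
    then show ?thesis
      by (rule le_less_trans[rotated]) simp
  qed
  have N: "?N p > 0" if "p \<in> ?S" for p
    using that \<open>\<rho> > 0\<close> by (auto simp: lattice_shell_def)
  define dir where "dir = (\<lambda>p i. p i / ?N p)"
  have inner_dir: "euclid_inner d q (dir p) = euclid_inner d q p / ?N p" for p q
    by (simp add: euclid_inner_def dir_def sum_divide_distrib)
  have dir1: "euclid_inner d (dir p) (dir p) = 1" if "p \<in> ?S" for p
    unfolding inner_dir[of "dir p" p] euclid_inner_commute[of d "dir p" p] inner_dir[of p p]
    using N[OF that] by (simp add: euclid_inner_self power2_eq_square)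
  have cone: "card {p \<in> ?S. c * ?N p \<le> euclid_inner d p x} \<le> cone_volume_bound n (c - \<delta>) * X"
    if "euclid_inner d x x = 1" "\<delta> < c" "c < 1" for c x
    using card_lattice_cone_le[where n = n and x = x and \<delta> = \<delta> and c = c and \<rho> = \<rho> and R = R] that assms(1,3,4)
    by (simp add: euclid_inner_def power2_eq_square X_def d_def cone_volume_bound_def mult_ac)
  have adj: "?N q / 2 \<le> euclid_inner d q (dir p)" if "p \<in> ?S" "q \<in> ?S" "?E p q" for p q
    using that N[of p] N[of q]
    by (auto simp: narrow_angle_def inner_dir euclid_inner_self euclid_inner_commute[of d q p] power2_eq_square field_simps)
  have deg: "real (card {w \<in> ?S. ?E v w}) \<le> \<Delta>" if v: "v \<in> ?S" for v
  proof -
    have "card {w \<in> ?S. ?E v w} \<le> card {p \<in> ?S. (1 / 2) * ?N p \<le> euclid_inner d p (dir v)}"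
      using adj[OF v] by (intro card_mono finite_subset[OF _ finite_lattice_shell[of d \<rho> R]]) auto
    moreover have "real (card {p \<in> ?S. (1 / 2) * ?N p \<le> euclid_inner d p (dir v)}) \<le> \<Delta>"
      unfolding \<Delta>_def A_def using cone[OF dir1[OF v], of "1 / 2"] assms by simp
    ultimately show ?thesis
      by linarith
  qed
  have sparse: "(\<Sum>x\<in>T. real (card {y \<in> T. ?E x y})) \<le> K * real (card T)"
    if v: "v \<in> ?S" and T: "T \<subseteq> {w \<in> ?S. ?E v w}" for v T
  proof -
    \<comment> \<open>neighbours are ranked by their closeness to \<open>v\<close> in angle\<close>
    define t where "t = (\<lambda>p. euclid_inner d (dir p) (dir v))"
    have finT: "finite T"
      using T by (intro finite_subset[OF _ finite_lattice_shell[of d \<rho> R]]) auto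
    have "real (card {y \<in> T. ?E x y \<and> t x \<le> t y}) \<le> cone_volume_bound n (1 / sqrt 3 - \<delta>) * X"
      if "x \<in> T" for x
    proof -
      have x: "x \<in> ?S" "?E v x"
        using that T by auto
      have t_eq: "t p = euclid_inner d p (dir v) / ?N p" for p
        unfolding t_def by (subst euclid_inner_commute) (simp add: inner_dir euclid_inner_commute)
      have "1 / 2 \<le> t x"
        unfolding t_eq using adj[OF v x] N[OF x(1)] by (simp add: field_simps)
      then obtain m where m: "euclid_inner d m m = 1"
        "\<And>p r. \<lbrakk>0 \<le> r; r / 2 \<le> euclid_inner d p (dir x); r * t x \<le> euclid_inner d p (dir v)\<rbrakk>
          \<Longrightarrow> r / sqrt 3 \<le> euclid_inner d p m"
        using lens_in_cone[OF dir1[OF x(1)] dir1[OF v]] unfolding t_def by metis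
      have "1 / sqrt 3 * ?N y \<le> euclid_inner d y m" if y: "y \<in> T" "?E x y" "t x \<le> t y" for y
      proof -
        have yS: "y \<in> ?S"
          using y T by auto
        have "?N y * t x \<le> euclid_inner d y (dir v)"
          using y(3) N[OF yS] by (simp add: t_eq[of y] field_simps)
        then show ?thesis
          using m(2)[of "?N y" y] adj[OF x(1) yS y(2)] by simp
      qed
      then have "card {y \<in> T. ?E x y \<and> t x \<le> t y} \<le> card {p \<in> ?S. 1 / sqrt 3 * ?N p \<le> euclid_inner d p m}"
        using T by (intro card_mono finite_subset[OF _ finite_lattice_shell[of d \<rho> R]]) auto
      moreover have "real (card {p \<in> ?S. 1 / sqrt 3 * ?N p \<le> euclid_inner d p m}) \<le> cone_volume_bound n (1 / sqrt 3 - \<delta>) * X"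
        using assms(1,2) s3 by (intro cone m(1)) linarith+
      ultimately show ?thesis
        by linarith
    qed
    from sum_card_related_le[OF finT symp_narrow_angle this] show ?thesis
      by (simp add: K_def B_def)
  qed
  define \<phi> where "\<phi> = 1 / (K * d)"
  have \<phi>: "\<phi> > 0"
    using K d by (simp add: \<phi>_def)
  obtain I where I: "I \<in> independent_sets ?E ?S"
    "(1 + ln (A / (B * (real d)\<^sup>2))) * real (card ?S)
      \<le> (exp (ln (A / (B * (real d)\<^sup>2))) / \<phi> + exp (\<phi> * K) * \<Delta>) * real (card I)"
    by (rule large_independent_set[OF finite_lattice_shell \<phi> reflp_narrow_angle symp_narrow_angle deg sparse])
  have "\<phi> * K = 1 / d" "exp (ln (A / (B * (real d)\<^sup>2))) / \<phi> = \<Delta> / d"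
    using A B K X d by (auto simp: \<phi>_def \<Delta>_def K_def power2_eq_square)
  then have c: "exp (ln (A / (B * (real d)\<^sup>2))) / \<phi> + exp (\<phi> * K) * \<Delta> = \<Delta> * (exp (1 / d) + 1 / d)"
    by (simp add: algebra_simps)
  have "card I \<le> kissing_number d"
    using I(1) finite_lattice_shell N by (rule card_independent_le_kissing_number)
  then have "\<Delta> * (exp (1 / d) + 1 / d) * real (card I) \<le> \<Delta> * (exp (1 / d) + 1 / d) * real (kissing_number d)"
    using \<Delta> d by (intro mult_left_mono) auto
  then show ?thesis
    using I(2) unfolding c by (simp add: \<Delta>_def X_def)
qed

text \<open>
  As \<open>R\<close> grows with the core fixed, the rounding errors in the two volumes become negligible;
  only the perturbation \<open>\<delta>\<close> of the angles remains.
\<close>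

lemma kissing_number_perturbed_bound:
  fixes n :: nat and \<delta> :: real
  assumes \<delta>: "0 < \<delta>" "\<delta> < 1 / 2"
  defines "A \<equiv> cone_volume_bound n (1 / 2 - \<delta>)" and "B \<equiv> 2 * cone_volume_bound n (1 / sqrt 3 - \<delta>)"
    and "d \<equiv> Suc n"
  shows "(1 + ln (A / (B * (real d)\<^sup>2))) * unit_ball_vol d
    \<le> A * (exp (1 / d) + 1 / d) * real (kissing_number d)"
proof (cases "0 \<le> 1 + ln (A / (B * (real d)\<^sup>2))")
  case False
  have "A > 0"
    unfolding A_def using \<delta> by (intro cone_volume_bound_pos) auto
  have "(1 + ln (A / (B * (real d)\<^sup>2))) * unit_ball_vol d \<le> 0"
    using False by (intro mult_nonpos_nonneg) auto
  also have "0 \<le> A * (exp (1 / d) + 1 / d) * real (kissing_number d)"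
    using \<open>A > 0\<close> by (intro mult_nonneg_nonneg add_nonneg_nonneg) auto
  finally show ?thesis .
next
  case True
  define L where "L = 1 + ln (A / (B * (real d)\<^sup>2))"
  define W where "W = A * (exp (1 / d) + 1 / d) * real (kissing_number d)"
  \<comment> \<open>the condition on \<open>\<rho>\<close> in the lattice bound holds with equality\<close>
  define \<rho> where "\<rho> = sqrt d + 2 * sqrt d / \<delta>"
  have "\<rho> > 0"
    using \<delta> by (simp add: \<rho>_def d_def add_pos_pos)
  let ?v = "unit_ball_vol d"
  have ineq: "L * (?v * (1 - sqrt d / R) ^ d - ?v * (\<rho> + sqrt d) ^ d * (1 / R) ^ d) \<le> W * (1 + sqrt d / R) ^ d"
    if R: "R > sqrt d" for R
  proof -
    have "R > 0"
      using R by (rule le_less_trans[rotated]) simp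
    have "L * (?v * (R - sqrt d) ^ d - ?v * (\<rho> + sqrt d) ^ d) \<le> L * real (card (lattice_shell d \<rho> R))"
      using True card_lattice_shell_ge[OF \<open>\<rho> > 0\<close> R] by (intro mult_left_mono) (auto simp: L_def)
    also have "\<dots> \<le> A * (R + sqrt d) ^ d * (exp (1 / d) + 1 / d) * real (kissing_number d)"
      unfolding L_def A_def B_def d_def using \<delta> \<open>R > 0\<close>
      by (intro kissing_number_lattice_bound) (auto simp: \<rho>_def d_def)
    also have "\<dots> = W * (R + sqrt d) ^ d"
      by (simp add: W_def)
    finally have "(1 / R) ^ d * (L * (?v * (R - sqrt d) ^ d - ?v * (\<rho> + sqrt d) ^ d)) \<le> (1 / R) ^ d * (W * (R + sqrt d) ^ d)"
      using \<open>R > 0\<close> by (intro mult_left_mono) auto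
    moreover have "(1 / R) ^ d * (R - sqrt d) ^ d = (1 - sqrt d / R) ^ d"
      "(1 / R) ^ d * (R + sqrt d) ^ d = (1 + sqrt d / R) ^ d"
      using \<open>R > 0\<close> by (simp_all add: power_mult_distrib[symmetric] field_simps)
    ultimately show ?thesis
      by (simp only: right_diff_distrib mult_ac)
  qed
  have zero: "((\<lambda>R. C / R) \<longlongrightarrow> 0) at_top" for C :: real
    by real_asymp
  have lhs: "((\<lambda>R. L * (?v * (1 - sqrt d / R) ^ d - ?v * (\<rho> + sqrt d) ^ d * (1 / R) ^ d))
      \<longlongrightarrow> L * (?v * (1 - 0) ^ d - ?v * (\<rho> + sqrt d) ^ d * 0 ^ d)) at_top"
    by (intro tendsto_intros zero)
  have rhs: "((\<lambda>R. W * (1 + sqrt d / R) ^ d) \<longlongrightarrow> W * (1 + 0) ^ d) at_top"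
    by (intro tendsto_intros zero)
  have ev: "\<forall>\<^sub>F R in at_top. L * (?v * (1 - sqrt d / R) ^ d - ?v * (\<rho> + sqrt d) ^ d * (1 / R) ^ d)
      \<le> W * (1 + sqrt d / R) ^ d"
    using eventually_gt_at_top[of "sqrt d"] by (rule eventually_mono) (rule ineq)
  have "L * (?v * (1 - 0) ^ d - ?v * (\<rho> + sqrt d) ^ d * 0 ^ d) \<le> W * (1 + 0) ^ d"
    by (rule tendsto_le[OF _ rhs lhs ev]) simp
  then show ?thesis
    by (simp add: L_def W_def d_def)
qed

text \<open>
  In a fixed dimension both sides are continuous in the angles, so \<open>\<delta>\<close> may tend to \<open>0\<close>.
\<close>

lemma kissing_number_bound:
  fixes n :: nat
  defines "A \<equiv> cone_volume_bound n (1 / 2)" and "B \<equiv> 2 * cone_volume_bound n (1 / sqrt 3)"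
    and "d \<equiv> Suc n"
  shows "(1 + ln (A / (B * (real d)\<^sup>2))) * unit_ball_vol d
    \<le> A * (exp (1 / d) + 1 / d) * real (kissing_number d)"
proof -
  have "1 / sqrt 3 < 1"
    by simp
  then have AB: "A > 0" "B > 0"
    unfolding A_def B_def by (auto intro!: cone_volume_bound_pos)
  have lim: "((\<lambda>\<delta>. cone_volume_bound n (c - \<delta>)) \<longlongrightarrow> cone_volume_bound n c) (at_right 0)" if "c > 0" for c
  proof -
    have id: "((\<lambda>\<delta>. c - \<delta>) \<longlongrightarrow> c - 0) (at_right 0)"
      by (intro tendsto_intros)
    show ?thesis
      unfolding cone_volume_bound_def using that id by (auto intro!: tendsto_eq_intros)
  qed
  have A: "((\<lambda>\<delta>. cone_volume_bound n (1 / 2 - \<delta>)) \<longlongrightarrow> A) (at_right 0)"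
    and B: "((\<lambda>\<delta>. 2 * cone_volume_bound n (1 / sqrt 3 - \<delta>)) \<longlongrightarrow> B) (at_right 0)"
    unfolding A_def B_def by (intro tendsto_mult tendsto_const lim; simp)+
  have lhs: "((\<lambda>\<delta>. (1 + ln (cone_volume_bound n (1 / 2 - \<delta>) / (2 * cone_volume_bound n (1 / sqrt 3 - \<delta>) * (real d)\<^sup>2))) * unit_ball_vol d)
      \<longlongrightarrow> (1 + ln (A / (B * (real d)\<^sup>2))) * unit_ball_vol d) (at_right 0)"
    using AB by (intro tendsto_intros A B) (auto simp: d_def)
  have rhs: "((\<lambda>\<delta>. cone_volume_bound n (1 / 2 - \<delta>) * (exp (1 / d) + 1 / d) * real (kissing_number d))
      \<longlongrightarrow> A * (exp (1 / d) + 1 / d) * real (kissing_number d)) (at_right 0)"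
    by (intro tendsto_intros A)
  have ev: "\<forall>\<^sub>F \<delta> in at_right 0. (1 + ln (cone_volume_bound n (1 / 2 - \<delta>) / (2 * cone_volume_bound n (1 / sqrt 3 - \<delta>) * (real d)\<^sup>2))) * unit_ball_vol d
      \<le> cone_volume_bound n (1 / 2 - \<delta>) * (exp (1 / d) + 1 / d) * real (kissing_number d)"
  proof -
    have "\<forall>\<^sub>F \<delta> in at_right 0. \<delta> \<in> {0<..<1 / 2 :: real}"
      by (rule eventually_at_right_real) simp
    then show ?thesis
      unfolding d_def by (rule eventually_mono) (rule kissing_number_perturbed_bound; simp)
  qed
  show ?thesis
    by (rule tendsto_le[OF _ rhs lhs ev]) simp
qed

section \<open>Asymptotics\<close>

text \<open>
  The point \<open>x + 1/2\<close> is the midpoint of \<open>x\<close> and \<open>x + 1\<close>, and \<open>ln \<circ> Gamma\<close> is convex.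
\<close>

lemma Gamma_add_half_le:
  fixes x :: real
  assumes "x > 0"
  shows "Gamma (x + 1 / 2) \<le> sqrt x * Gamma x"
proof -
  have pos: "Gamma x > 0" "Gamma (x + 1) > 0" "Gamma (x + 1 / 2) > 0"
    using assms by (auto intro!: Gamma_real_pos)
  have "x \<notin> \<int>\<^sub>\<le>\<^sub>0"
    using assms by (auto elim!: nonpos_Ints_cases)
  then have plus1: "Gamma (x + 1) = x * Gamma x"
    by (rule Gamma_plus1)
  have "(ln \<circ> Gamma) ((1 - 1 / 2) *\<^sub>R x + (1 / 2) *\<^sub>R (x + 1))
      \<le> (1 - 1 / 2) * (ln \<circ> Gamma) x + (1 / 2) * (ln \<circ> Gamma) (x + 1)"
    using assms by (intro convex_onD[OF log_convex_Gamma_real]) auto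
  moreover have "(1 - 1 / 2) *\<^sub>R x + (1 / 2) *\<^sub>R (x + 1) = x + 1 / 2"
    by (simp add: field_simps)
  ultimately have "2 * ln (Gamma (x + 1 / 2)) \<le> ln (Gamma x) + ln (Gamma (x + 1))"
    by (simp add: field_simps)
  also have "\<dots> = ln (x * (Gamma x)\<^sup>2)"
    using pos assms by (simp add: plus1 ln_mult power2_eq_square)
  finally have "ln ((Gamma (x + 1 / 2))\<^sup>2) \<le> ln (x * (Gamma x)\<^sup>2)"
    using pos by (simp add: ln_realpow)
  then have "(Gamma (x + 1 / 2))\<^sup>2 \<le> x * (Gamma x)\<^sup>2"
    using ln_le_cancel_iff[OF zero_less_power[OF pos(3)] mult_pos_pos[OF assms zero_less_power[OF pos(1)]]]
    by blast
  then have "(Gamma (x + 1 / 2))\<^sup>2 \<le> (sqrt x * Gamma x)\<^sup>2"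
    using assms by (simp add: power_mult_distrib)
  then show ?thesis
    by (rule power2_le_imp_le) (use pos assms in auto)
qed

lemma unit_ball_vol_ratio_le:
  "unit_ball_vol (real n) \<le> sqrt ((real n + 2) / (2 * pi)) * unit_ball_vol (real (Suc n))"
proof -
  define x where "x = real n / 2 + 1"
  have x: "x > 0"
    by (simp add: x_def)
  have pos: "Gamma x > 0" "Gamma (x + 1 / 2) > 0"
    using x by (auto intro!: Gamma_real_pos)
  have v1: "unit_ball_vol (real n) = pi powr (real n / 2) / Gamma x"
    by (simp add: unit_ball_vol_def x_def)
  have v2: "unit_ball_vol (real (Suc n)) = pi powr (real n / 2) * sqrt pi / Gamma (x + 1 / 2)"
  proof -
    have "real (Suc n) / 2 = real n / 2 + 1 / 2"
      by (simp add: field_simps)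
    then show ?thesis
      unfolding unit_ball_vol_def x_def by (simp only:) (simp add: powr_add powr_half_sqrt add_ac)
  qed
  have "sqrt ((real n + 2) / (2 * pi)) = sqrt x / sqrt pi"
    by (simp add: x_def real_sqrt_divide[symmetric] field_simps)
  then have "sqrt ((real n + 2) / (2 * pi)) * unit_ball_vol (real (Suc n)) = pi powr (real n / 2) * (sqrt x / Gamma (x + 1 / 2))"
    unfolding v2 by simp
  moreover have "1 / Gamma x \<le> sqrt x / Gamma (x + 1 / 2)"
    using Gamma_add_half_le[OF x] pos by (simp add: field_simps)
  ultimately show ?thesis
    unfolding v1 using mult_left_mono[of "1 / Gamma x" "sqrt x / Gamma (x + 1 / 2)" "pi powr (real n / 2)"] by simp
qed

text \<open>
  The bound in terms of \<open>d\<close> alone. The factors before \<open>sqrt (3 * pi / 8)\<close> form the ratio to the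
  main term and tend to \<open>1\<close>: the square root comes from the volumes of unit balls, \<open>(\<dots>) / (d * L)\<close>
  from the logarithm, and the last denominator from the error terms of the hard-core model. The
  hypothesis, valid in large dimensions, keeps the direction of the estimate when the unit ball
  volumes are compared.
\<close>

lemma kissing_number_explicit_bound:
  fixes n :: nat
  defines "d \<equiv> real (Suc n)" and "L \<equiv> ln (3 / (2 * sqrt 2))"
  assumes nonneg: "0 \<le> 1 + real n * L - ln (sqrt 3) - 2 * ln d"
  shows "real (kissing_number (Suc n)) \<ge>
    sqrt (d / (d + 1)) * (1 + real n * L - ln (sqrt 3) - 2 * ln d) / (d * L) / (exp (1 / d) + 1 / d)
    * sqrt (3 * pi / 8) * L * (d powr (3 / 2) * (2 / sqrt 3) ^ Suc n)"
proof -
  define V where "V = unit_ball_vol (real n)"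
  define A B where "A = cone_volume_bound n (1 / 2)" and "B = 2 * cone_volume_bound n (1 / sqrt 3)"
  define l where "l = 1 + real n * L - ln (sqrt 3) - 2 * ln d"
  define w where "w = exp (1 / d) + 1 / d"
  let ?k = "real (kissing_number (Suc n))"
  have d: "d > 0"
    by (simp add: d_def)
  have w: "w > 0"
    using d by (simp add: w_def add_pos_pos)
  have V: "V > 0"
    by (simp add: V_def)
  have "2 * sqrt 2 < 3"
    by (rule power2_less_imp_less) (auto simp: power_mult_distrib)
  then have L: "L > 0"
    by (simp add: L_def)
  have A: "A = V * (sqrt 3 / 2) ^ n * 2 / d"
  proof -
    have "sqrt (1 - (1 / 2)\<^sup>2) = sqrt 3 / 2"
      by (simp add: power_divide real_sqrt_divide)
    then show ?thesis
      unfolding A_def cone_volume_bound_def V_def[symmetric] d_def[symmetric] by (simp only:) simp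
  qed
  have B: "B = 2 * V * (sqrt 2 / sqrt 3) ^ n * sqrt 3 / d"
  proof -
    have "sqrt (1 - (1 / sqrt 3)\<^sup>2) = sqrt 2 / sqrt 3"
      by (simp add: power_divide real_sqrt_divide[symmetric])
    then show ?thesis
      unfolding B_def cone_volume_bound_def V_def[symmetric] d_def[symmetric] by (simp only:) simp
  qed
  have "A / (B * d\<^sup>2) = (3 / (2 * sqrt 2)) ^ n / (sqrt 3 * d\<^sup>2)"
  proof -
    have "sqrt 3 / 2 = 3 / (2 * sqrt 2) * (sqrt 2 / sqrt 3)"
      by (simp add: real_div_sqrt)
    then have "(sqrt 3 / 2) ^ n = (3 / (2 * sqrt 2)) ^ n * (sqrt 2 / sqrt 3) ^ n"
      by (simp only: power_mult_distrib)
    then show ?thesis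
      using V d by (simp add: A B)
  qed
  also have "ln \<dots> = real n * L - (ln (sqrt 3) + 2 * ln d)"
    using d by (simp add: L_def ln_div ln_mult ln_realpow)
  finally have ln_eq: "1 + ln (A / (B * d\<^sup>2)) = l"
    by (simp add: l_def)
  have l: "l \<ge> 0"
    using nonneg by (simp add: l_def)
  have "l * V \<le> l * (sqrt ((d + 1) / (2 * pi)) * unit_ball_vol d)"
    using unit_ball_vol_ratio_le[of n] l by (intro mult_left_mono) (auto simp: V_def d_def add_ac)
  also have "\<dots> \<le> sqrt ((d + 1) / (2 * pi)) * (A * w * ?k)"
  proof -
    have "l * unit_ball_vol d \<le> A * w * ?k"
      using kissing_number_bound[of n] unfolding A_def[symmetric] B_def[symmetric] d_def[symmetric] ln_eq w_def .
    from mult_left_mono[OF this, of "sqrt ((d + 1) / (2 * pi))"] show ?thesis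
      using d by (simp add: mult_ac)
  qed
  also have "\<dots> = V * (sqrt ((d + 1) / (2 * pi)) * ((sqrt 3 / 2) ^ n * 2 / d) * w * ?k)"
    by (simp add: A)
  finally have "l * V \<le> V * (sqrt ((d + 1) / (2 * pi)) * ((sqrt 3 / 2) ^ n * 2 / d) * w * ?k)" .
  then have main: "l \<le> sqrt ((d + 1) / (2 * pi)) * ((sqrt 3 / 2) ^ n * 2 / d) * w * ?k"
    using V by (metis mult.commute mult_le_cancel_left_pos)
  define c where "c = sqrt (d / (d + 1)) / (d * w) * sqrt (3 * pi / 8) * d powr (3 / 2) * (2 / sqrt 3) ^ Suc n"
  have "c \<ge> 0"
    using d w by (simp add: c_def)
  have "c * (sqrt ((d + 1) / (2 * pi)) * ((sqrt 3 / 2) ^ n * 2 / d) * w) = 1"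
  proof -
    have p: "d powr (3 / 2) = d * sqrt d"
      using d powr_add[of d 1 "1/2"] by (simp add: powr_half_sqrt)
    have q: "(2 / sqrt 3) ^ Suc n * (sqrt 3 / 2) ^ n = 2 / sqrt 3"
    proof -
      have "(2 / sqrt 3) ^ n * (sqrt 3 / 2) ^ n = 1"
        by (simp add: power_mult_distrib[symmetric])
      then show ?thesis
        by simp
    qed
    have r: "sqrt (d / (d + 1)) * sqrt (3 * pi / 8) * sqrt d * sqrt ((d + 1) / (2 * pi)) = d * sqrt 3 / 4"
    proof -
      have "sqrt (d / (d + 1)) * sqrt (3 * pi / 8) * sqrt d * sqrt ((d + 1) / (2 * pi))
          = sqrt (d / (d + 1) * (3 * pi / 8) * d * ((d + 1) / (2 * pi)))"
        by (simp only: real_sqrt_mult)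
      also have "d / (d + 1) * (3 * pi / 8) * d * ((d + 1) / (2 * pi)) = 3 * (d / 4)\<^sup>2"
      proof -
        have "d / e * (3 * p / 8) * d * (e / (2 * p)) = 3 * (d / 4)\<^sup>2" if "e > 0" "p > 0" for e p :: real
          using that by (simp add: field_simps power2_eq_square)
        then show ?thesis
          using d pi_gt_zero by (metis add_pos_pos zero_less_one)
      qed
      finally show ?thesis
        using d by (simp add: real_sqrt_mult)
    qed
    have "c * (sqrt ((d + 1) / (2 * pi)) * ((sqrt 3 / 2) ^ n * 2 / d) * w)
      = (sqrt (d / (d + 1)) * sqrt (3 * pi / 8) * sqrt d * sqrt ((d + 1) / (2 * pi)))
        * ((2 / sqrt 3) ^ Suc n * (sqrt 3 / 2) ^ n) * (2 / d)"
      using d w unfolding c_def p by (simp add: field_simps del: power_Suc)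
    also have "\<dots> = 1"
      unfolding q r using d by simp
    finally show ?thesis .
  qed
  then have "c * l \<le> ?k"
    using mult_left_mono[OF main \<open>c \<ge> 0\<close>] by (simp only: mult.assoc[symmetric])
  also have "c * l = sqrt (d / (d + 1)) * l / (d * L) / w * sqrt (3 * pi / 8) * L * (d powr (3 / 2) * (2 / sqrt 3) ^ Suc n)"
    using L d w by (simp add: c_def field_simps del: power_Suc)
  finally show ?thesis
    by (simp add: l_def w_def)
qed

theorem theorem1:
  shows "\<exists>\<epsilon> :: nat \<Rightarrow> real. \<epsilon> \<longlonglongrightarrow> 0 \<and>
    (\<forall>\<^sub>F d in sequentially.
       real (kissing_number d) \<ge>
         (1 + \<epsilon> d) * sqrt (3 * pi / 8) * ln (3 / (2 * sqrt 2)) *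
         (real d powr (3 / 2) * (2 / sqrt 3) ^ d))"
proof -
  define L where "L = ln (3 / (2 * sqrt 2))"
  define l where "l = (\<lambda>d::real. 1 + (d - 1) * L - ln (sqrt 3) - 2 * ln d)"
  define r where "r = (\<lambda>d::real. sqrt (d / (d + 1)) * l d / (d * L) / (exp (1 / d) + 1 / d))"
  have "2 * sqrt 2 < 3"
    by (rule power2_less_imp_less) (auto simp: power_mult_distrib)
  then have "L > 0"
    by (simp add: L_def)
  have l_pos: "\<forall>\<^sub>F d in sequentially. 0 \<le> l (real d)"
    unfolding l_def using \<open>L > 0\<close> by real_asymp
  have "(\<lambda>d. r (real d) - 1) \<longlonglongrightarrow> 0"
    unfolding r_def l_def using \<open>L > 0\<close> by real_asymp
  moreover have "\<forall>\<^sub>F d in sequentially. real (kissing_number d) \<ge>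
      (1 + (r (real d) - 1)) * sqrt (3 * pi / 8) * ln (3 / (2 * sqrt 2)) * (real d powr (3 / 2) * (2 / sqrt 3) ^ d)"
    using l_pos eventually_gt_at_top[of 0]
  proof eventually_elim
    case (elim d)
    then obtain n where d: "d = Suc n"
      using gr0_implies_Suc by blast
    show ?case
      using kissing_number_explicit_bound[of n] elim(1) by (simp add: d r_def l_def L_def)
  qed
  ultimately show ?thesis
    by blast
qed

end
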